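(* Let $n\ge 2$ be an integer, $\varepsilon>0$ and $\tfrac12<s<\tfrac34$. For a point $\mathbf d=(d_1,d_2)\in\mathbb R^2$ there exist positive constants $c_0=c_0(n,\varepsilon,\mathbf d)$, $c_4=c_4(n,\varepsilon,\mathbf d)$ and $Q_0=Q_0(n,\varepsilon,\mathbf d,s)$ such that the following holds. Let $Q>Q_0$ and let $\overline\Pi=I_1\times I_2$ be a square with midpoint $\mathbf d$ and side lengths $\mu_1I_1=\mu_1I_2=c_3Q^{-s}$ with $c_3>c_0$, such that $\overline\Pi\cap\{(x_1,x_2)\in\mathbb R^2:\ |x_1-x_2|<\varepsilon\}=\emptyset$ and $\overline\Pi$ is $(\tfrac12,\tfrac12)$-ordinary. Then $$\#\mathcal A_n^2(Q,\overline\Pi)\ge c_4\,Q^{n+1}\mu_2\overline\Pi .$$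
   Context: For $Q>0$, $\mathcal P_n(Q)$ denotes the set of polynomials $P\in\mathbb Z[t]$ with $\deg P\le n$ and height $H(P)=\max_j|a_j|\le Q$, where $P(t)=a_nt^n+\dots+a_0$. A point $\boldsymbol\alpha=(\alpha_1,\alpha_2)\in\mathbb R^2$ is an algebraic point if $\alpha_1,\alpha_2$ are roots of a common polynomial in $\mathbb Z[t]$; its minimal polynomial is the polynomial of smallest degree in $\mathbb Z[t]$ vanishing at $\alpha_1$ and $\alpha_2$ with coprime coefficients, and the degree and height of $\boldsymbol\alpha$ are those of its minimal polynomial. $\mathcal A_n^2(Q)$ is the set of algebraic points of degree at most $n$ and height at most $Q$, and $\mathcal A_n^2(Q,D)=\mathcal A_n^2(Q)\cap D$. $\mu_1,\mu_2$ denote Lebesgue measure on $\mathbb R$, $\mathbb R^2$. Ordinary squares: let $\overline\Pi$ be a square with sides of length $c_3Q^{-s}$, $\tfrac12<s<\tfrac34$, and let $u_1,u_2>0$ with $u_1+u_2=1$. $\overline\Pi$ is called $(u_1,u_2)$-ordinary if it contains no point $(x_1',x_2')$ for which there exists a polynomial $P(t)=b_2t^2+b_1t+b_0\in\mathcal P_2(Q)$ with $|P(x_i')|\ll Q^{-u_i}$ for $i=1,2$ and $|b_2|<Q^{s-1/2}$ (here $\ll$ means $\le$ a fixed positive constant times, independent of $Q$); otherwise it is called $(u_1,u_2)$-special. *)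

theory Defs
  imports "HOL-Analysis.Analysis" "HOL-Computational_Algebra.Computational_Algebra"
begin

definition eval_real :: "int poly \<Rightarrow> real \<Rightarrow> real" where
  "eval_real P x = poly (map_poly real_of_int P) x"

definition poly_height :: "int poly \<Rightarrow> int" where
  "poly_height P = Max ((\<lambda>j. \<bar>coeff P j\<bar>) ` {..degree P})"

definition polys_bounded :: "nat \<Rightarrow> real \<Rightarrow> int poly set" where
  "polys_bounded n Q = {P. degree P \<le> n \<and> real_of_int (poly_height P) \<le> Q}"

definition vanishes_at :: "int poly \<Rightarrow> real \<times> real \<Rightarrow> bool" where
  "vanishes_at P \<alpha> \<longleftrightarrow> eval_real P (fst \<alpha>) = 0 \<and> eval_real P (snd \<alpha>) = 0"

definition algebraic_point :: "real \<times> real \<Rightarrow> bool" where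
  "algebraic_point \<alpha> \<longleftrightarrow> (\<exists>P. P \<noteq> 0 \<and> vanishes_at P \<alpha>)"

definition is_min_poly :: "int poly \<Rightarrow> real \<times> real \<Rightarrow> bool" where
  "is_min_poly P \<alpha> \<longleftrightarrow> P \<noteq> 0 \<and> vanishes_at P \<alpha> \<and> content P = 1 \<and>
     (\<forall>R. R \<noteq> 0 \<and> vanishes_at R \<alpha> \<longrightarrow> degree P \<le> degree R)"

text \<open>The minimal polynomial is determined only up to sign (see \<open>is_min_poly_unique\<close> below);
  the choice affects neither its degree nor its height.\<close>

definition min_poly :: "real \<times> real \<Rightarrow> int poly" where
  "min_poly \<alpha> = (SOME P. is_min_poly P \<alpha>)"

definition point_degree :: "real \<times> real \<Rightarrow> nat" where
  "point_degree \<alpha> = degree (min_poly \<alpha>)"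

definition point_height :: "real \<times> real \<Rightarrow> int" where
  "point_height \<alpha> = poly_height (min_poly \<alpha>)"

definition algebraic_points :: "nat \<Rightarrow> real \<Rightarrow> (real \<times> real) set" where
  "algebraic_points n Q =
     {\<alpha>. algebraic_point \<alpha> \<and> point_degree \<alpha> \<le> n \<and> real_of_int (point_height \<alpha>) \<le> Q}"

definition algebraic_points_in :: "nat \<Rightarrow> real \<Rightarrow> (real \<times> real) set \<Rightarrow> (real \<times> real) set" where
  "algebraic_points_in n Q D = algebraic_points n Q \<inter> D"

text \<open>\<open>K\<close> is the fixed constant implied by the Vinogradov symbol in the bounds on \<open>\<bar>P(x\<^sub>i)\<bar>\<close>.
  The zero polynomial has to be excluded: otherwise every nonempty set would be special.\<close>

definition special ::
  "real \<Rightarrow> real \<Rightarrow> real \<Rightarrow> real \<Rightarrow> real \<Rightarrow> (real \<times> real) set \<Rightarrow> bool" where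
  "special K s u\<^sub>1 u\<^sub>2 Q S \<longleftrightarrow>
     (\<exists>x\<^sub>1 x\<^sub>2. (x\<^sub>1, x\<^sub>2) \<in> S \<and>
       (\<exists>P\<in>polys_bounded 2 Q. P \<noteq> 0 \<and>
          \<bar>eval_real P x\<^sub>1\<bar> \<le> K * Q powr (- u\<^sub>1) \<and>
          \<bar>eval_real P x\<^sub>2\<bar> \<le> K * Q powr (- u\<^sub>2) \<and>
          \<bar>real_of_int (coeff P 2)\<bar> < Q powr (s - 1/2)))"

definition ordinary ::
  "real \<Rightarrow> real \<Rightarrow> real \<Rightarrow> real \<Rightarrow> real \<Rightarrow> (real \<times> real) set \<Rightarrow> bool" where
  "ordinary K s u\<^sub>1 u\<^sub>2 Q S \<longleftrightarrow> \<not> special K s u\<^sub>1 u\<^sub>2 Q S"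

lemma eval_real_smult [simp]: "eval_real (smult a P) x = real_of_int a * eval_real P x"
proof -
  have "map_poly real_of_int (smult a P) = smult (real_of_int a) (map_poly real_of_int P)"
    by (rule poly_eqI) (simp add: coeff_map_poly)
  then show ?thesis by (simp add: eval_real_def)
qed

lemma eval_real_diff [simp]: "eval_real (P - R) x = eval_real P x - eval_real R x"
proof -
  have "map_poly real_of_int (P - R) = map_poly real_of_int P - map_poly real_of_int R"
    by (rule poly_eqI) (simp add: coeff_map_poly)
  then show ?thesis by (simp add: eval_real_def)
qed

lemma is_min_poly_exists:
  assumes "algebraic_point \<alpha>"
  shows "\<exists>P. is_min_poly P \<alpha>"
proof -
  define A where "A = (\<lambda>P. P \<noteq> 0 \<and> vanishes_at P \<alpha>)"
  from assms obtain P0 where "A P0" by (auto simp: A_def algebraic_point_def)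
  then obtain P where P: "A P" "\<And>R. A R \<Longrightarrow> degree P \<le> degree R"
    using ex_has_least_nat[of A P0 degree] by blast
  define R where "R = primitive_part P"
  have PR: "P = smult (content P) R" by (simp add: R_def)
  have c0: "content P \<noteq> 0" using P(1) by (simp add: A_def)
  have "eval_real R x = 0" if "eval_real P x = 0" for x
    using that c0 by (subst (asm) PR) simp
  then have "is_min_poly R \<alpha>"
    using P unfolding is_min_poly_def A_def R_def vanishes_at_def
    by (auto simp: content_primitive_part)
  then show ?thesis by blast
qed

lemma is_min_poly_unique:
  assumes "is_min_poly P \<alpha>" "is_min_poly R \<alpha>"
  shows "R = P \<or> R = - P"
proof -
  have nz: "P \<noteq> 0" "R \<noteq> 0" and c: "content P = 1" "content R = 1"
    using assms by (auto simp: is_min_poly_def)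
  have deg: "degree P = degree R"
    using assms by (intro antisym) (auto simp: is_min_poly_def)
  define D where "D = smult (lead_coeff R) P - smult (lead_coeff P) R"
  have van: "vanishes_at D \<alpha>"
    using assms by (simp add: D_def is_min_poly_def vanishes_at_def)
  have D0: "D = 0"
  proof (rule ccontr)
    assume D: "D \<noteq> 0"
    have "degree D \<le> degree P"
      unfolding D_def using deg by (intro degree_diff_le) auto
    moreover have "degree P \<le> degree D"
      using assms(1) van D by (auto simp: is_min_poly_def)
    moreover have "coeff D (degree P) = 0"
      by (simp add: D_def deg)
    ultimately show False using D by (metis antisym leading_coeff_0_iff)
  qed
  then have eq: "smult (lead_coeff R) P = smult (lead_coeff P) R" by (simp add: D_def)
  have "content (smult (lead_coeff R) P) = content (smult (lead_coeff P) R)"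
    by (rule arg_cong[OF eq])
  then have "\<bar>lead_coeff R\<bar> = \<bar>lead_coeff P\<bar>"
    by (simp only: content_smult c normalize_int_def mult_1_right)
  then consider "lead_coeff R = lead_coeff P" | "lead_coeff R = - lead_coeff P"
    by linarith
  then show ?thesis
  proof cases
    case 1
    have "coeff R i = coeff P i" for i
      using arg_cong[OF eq, of "\<lambda>p. coeff p i"] nz unfolding 1 by simp
    then show ?thesis by (simp add: poly_eq_iff)
  next
    case 2
    have "coeff R i = - coeff P i" for i
    proof -
      have "lead_coeff P * (- coeff P i) = lead_coeff P * coeff R i"
        using arg_cong[OF eq, of "\<lambda>p. coeff p i"] unfolding 2 by simp
      then show ?thesis using nz by (simp only: mult_cancel_left leading_coeff_0_iff) auto
    qed
    then show ?thesis by (simp add: poly_eq_iff)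
  qed
qed

end

theory Submission
  imports Defs
begin

text \<open>
  Write \<open>\<Delta> = \<bar>d\<^sub>1 - d\<^sub>2\<bar>\<close> and let \<open>L\<close> be the side of the square. Modulo \<open>(t - d\<^sub>1) (t - d\<^sub>2)\<close> every
  power of \<open>t\<close> is linear, so for any choice of integers \<open>a\<^sub>2, \<dots>, a\<^sub>n\<close> of size about \<open>Q\<close> there are
  about \<open>(L Q)\<^sup>2\<close> integer pairs \<open>(a\<^sub>1, a\<^sub>0)\<close> for which \<open>P = \<Sum> a\<^sub>l t\<^sup>l\<close> equals \<open>(t - d\<^sub>1) (t - d\<^sub>2) S(t)\<close>
  up to an error that is small compared with \<open>L \<Delta> Q\<close>. If \<open>a\<^sub>2\<close> dominates the higher coefficients,
  \<open>S\<close> is bounded below by a multiple of \<open>Q\<close>, and \<open>P\<close> has a root within \<open>L / 4\<close> of each \<open>d\<^sub>i\<close>.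
  Prescribing \<open>P \<equiv> t\<^sup>n + 2\<close> modulo 4 costs only a constant factor and makes \<open>P\<close> satisfy Eisenstein's
  criterion, hence \<open>P\<close> is an integer multiple of the minimal polynomial of its pair of roots. Polynomials
  whose coefficients have a common divisor \<open>k > M\<close> number at most
  \<open>\<Sum>\<^sub>k (C Q / k)\<^sup>n\<^sup>-\<^sup>1 (4 m / k + 2)\<^sup>2\<close> with \<open>m\<close> of order \<open>L Q\<close>; as \<open>s < 3/4\<close> gives \<open>m\<^sup>2 \<gg> \<surd>Q\<close>, this is
  less than half of the family when \<open>M\<close> is large. The others map to algebraic points of the square
  with fibres of size at most \<open>2 M + 1\<close>.
\<close>

section \<open>Minimal polynomials and Eisenstein's criterion at 2\<close>

text \<open>Exactly one factor, called \<open>u\<close>, has an even constant term, as 4 does not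
  divide the product of both. Its first odd coefficient, at index \<open>i\<close>, meets the odd
  constant term of the other factor, so coefficient \<open>i\<close> of the product is odd, whence
  \<open>n \<le> i \<le> degree u\<close>.\<close>

lemma eisenstein_two_degree:
  fixes f g :: "int poly"
  assumes top: "odd (coeff (f * g) n)" and low: "\<And>i. i < n \<Longrightarrow> even (coeff (f * g) i)"
    and "\<not> 4 dvd coeff (f * g) 0" and "n \<ge> 1"
  shows "n \<le> degree f \<or> n \<le> degree g"
proof -
  have key: "n \<le> degree u"
    if uv: "u * v = f * g" and u0: "even (coeff u 0)" and v0: "odd (coeff v 0)" for u v :: "int poly"
  proof -
    have "\<exists>i. odd (coeff u i)"
    proof (rule ccontr)
      assume "\<nexists>i. odd (coeff u i)"
      then have "even (coeff (u * v) n)" by (auto simp: coeff_mult intro!: dvd_sum)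
      with top uv show False by simp
    qed
    define i where "i = (LEAST i. odd (coeff u i))"
    have i: "odd (coeff u i)" unfolding i_def using \<open>\<exists>i. odd (coeff u i)\<close> by (metis LeastI_ex)
    have less: "even (coeff u j)" if "j < i" for j
      using not_less_Least that unfolding i_def by blast
    have "coeff (u * v) i = (\<Sum>j<i. coeff u j * coeff v (i - j)) + coeff u i * coeff v 0"
      by (simp add: coeff_mult flip: lessThan_Suc_atMost)
    moreover have "even (\<Sum>j<i. coeff u j * coeff v (i - j))"
      using less by (intro dvd_sum) auto
    ultimately have "odd (coeff (f * g) i)" using i v0 uv by simp
    then have "n \<le> i" using low not_le by blast
    also have "i \<le> degree u" using i by (intro le_degree) auto
    finally show ?thesis .
  qed
  have "even (coeff (f * g) 0)" using low \<open>n \<ge> 1\<close> by simp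
  then have "even (coeff f 0) \<or> even (coeff g 0)" by (simp add: coeff_mult)
  moreover have "\<not> (even (coeff f 0) \<and> even (coeff g 0))"
    using assms(3) mult_dvd_mono[of 2 "coeff f 0" 2 "coeff g 0"] by (auto simp: coeff_mult)
  ultimately show ?thesis using key[of f g] key[of g f] by (auto simp: mult.commute)
qed

lemma eval_real_mult: "eval_real (P * R) x = eval_real P x * eval_real R x"
proof -
  have "map_poly real_of_int (P * R) = map_poly real_of_int P * map_poly real_of_int R"
    by (rule poly_eqI) (simp add: coeff_map_poly coeff_mult)
  then show ?thesis by (simp add: eval_real_def)
qed

lemma eval_real_altdef:
  assumes "degree P \<le> n"
  shows "eval_real P x = (\<Sum>l\<le>n. real_of_int (coeff P l) * x ^ l)"
proof -
  have "eval_real P x = (\<Sum>l\<le>degree P. real_of_int (coeff P l) * x ^ l)"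
    by (simp add: eval_real_def poly_altdef coeff_map_poly degree_map_poly)
  also have "\<dots> = (\<Sum>l\<le>n. real_of_int (coeff P l) * x ^ l)"
    using assms by (intro sum.mono_neutral_left) (auto simp: coeff_eq_0)
  finally show ?thesis .
qed

text \<open>The pseudo-remainder of \<open>P\<close> by \<open>M\<close> also vanishes at
  \<open>\<alpha>\<close>, so minimality of the degree forces it to be zero.\<close>

lemma is_min_poly_dvd:
  assumes M: "is_min_poly M \<alpha>" and P: "vanishes_at P \<alpha>"
  shows "M dvd P"
proof -
  have M0: "M \<noteq> 0" and Mv: "vanishes_at M \<alpha>" and c: "content M = 1"
    and least: "\<And>R. R \<noteq> 0 \<Longrightarrow> vanishes_at R \<alpha> \<Longrightarrow> degree M \<le> degree R"
    using M by (auto simp: is_min_poly_def)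
  define r where "r = pseudo_mod P M"
  obtain a q where a: "a \<noteq> 0" "smult a P = M * q + r"
    using pseudo_mod(1)[OF M0, of P] by (auto simp: r_def)
  have "r = smult a P - M * q" using a by simp
  then have "vanishes_at r \<alpha>"
    using P Mv by (simp add: vanishes_at_def eval_real_mult)
  then have "r = 0" using least[of r] pseudo_mod(2)[OF M0, of P] unfolding r_def by force
  \<comment> \<open>Gauss's lemma: divisibility over the fraction field descends to the integers
    because \<open>M\<close> has content 1.\<close>
  then have "fract_poly M dvd fract_poly (smult a P)" using a by (simp add: dvdI)
  then have "fract_poly M dvd smult (to_fract a) (fract_poly P)" by (simp add: fract_poly_smult)
  then have "fract_poly M dvd fract_poly P" using a(1) by (simp add: dvd_smult_iff)
  then show ?thesis using c by (rule fract_poly_dvdD)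
qed

text \<open>By Eisenstein one factor of \<open>P = min_poly \<alpha> * q\<close> takes the whole
  degree. It is not \<open>q\<close>, since a nonzero polynomial with a root is not constant.
  \<open>P\<close> may be imprimitive, so a constant \<open>c\<close> remains.\<close>

lemma eisenstein_two_smult_min_poly:
  assumes "degree P = n" and "n \<ge> 1" and "odd (coeff P n)" and "\<And>i. i < n \<Longrightarrow> even (coeff P i)"
    and "\<not> 4 dvd coeff P 0" and van: "vanishes_at P \<alpha>"
  obtains c where "c \<noteq> 0" "P = smult c (min_poly \<alpha>)" "algebraic_point \<alpha>"
proof -
  have P0: "P \<noteq> 0" using assms by auto
  have alg: "algebraic_point \<alpha>" using P0 van by (auto simp: algebraic_point_def)
  have M: "is_min_poly (min_poly \<alpha>) \<alpha>"
    unfolding min_poly_def using is_min_poly_exists[OF alg] by (rule someI_ex)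
  obtain q where q: "P = min_poly \<alpha> * q" using is_min_poly_dvd[OF M van] by (elim dvdE)
  have nz: "min_poly \<alpha> \<noteq> 0" "q \<noteq> 0" using q P0 by auto
  have deg: "degree (min_poly \<alpha>) + degree q = n"
    using q nz assms(1) by (simp add: degree_mult_eq)
  have "degree (min_poly \<alpha>) \<noteq> 0"
  proof
    assume "degree (min_poly \<alpha>) = 0"
    then obtain a where a: "min_poly \<alpha> = [:a:]" by (rule degree_eq_zeroE)
    then have "eval_real (min_poly \<alpha>) x = of_int a" for x by (simp add: eval_real_def map_poly_pCons)
    then show False using M a by (auto simp: is_min_poly_def vanishes_at_def)
  qed
  moreover have "n \<le> degree (min_poly \<alpha>) \<or> n \<le> degree q"
    using eisenstein_two_degree[of "min_poly \<alpha>" q n] assms q by auto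
  ultimately have "degree q = 0" using deg by auto
  then obtain c where "q = [:c:]" by (rule degree_eq_zeroE)
  then have "P = smult c (min_poly \<alpha>)" using q by simp
  then show ?thesis using P0 alg that by force
qed

section \<open>Heights and finiteness of the set of algebraic points\<close>

lemma poly_height_le_iff: "real_of_int (poly_height P) \<le> Q \<longleftrightarrow> (\<forall>j\<le>degree P. \<bar>real_of_int (coeff P j)\<bar> \<le> Q)"
proof -
  have "real_of_int (poly_height P) \<le> Q \<longleftrightarrow> poly_height P \<le> \<lfloor>Q\<rfloor>" by (simp add: le_floor_iff)
  also have "\<dots> \<longleftrightarrow> (\<forall>j\<le>degree P. \<bar>coeff P j\<bar> \<le> \<lfloor>Q\<rfloor>)"
    unfolding poly_height_def by (subst Max_le_iff) auto
  also have "\<dots> \<longleftrightarrow> (\<forall>j\<le>degree P. \<bar>real_of_int (coeff P j)\<bar> \<le> Q)" by (simp add: le_floor_iff)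
  finally show ?thesis .
qed

lemma finite_polys_bounded: "finite (polys_bounded n Q)"
proof -
  define X where "X = {xs. set xs \<subseteq> {-\<lfloor>Q\<rfloor>..\<lfloor>Q\<rfloor>} \<and> length xs \<le> Suc n}"
  have "P \<in> Poly ` X" if "P \<in> polys_bounded n Q" for P
  proof -
    have "\<bar>coeff P j\<bar> \<le> \<lfloor>Q\<rfloor>" if "j \<le> degree P" for j
      using that \<open>P \<in> _\<close> by (simp add: polys_bounded_def poly_height_le_iff le_floor_iff)
    then have "set (coeffs P) \<subseteq> {-\<lfloor>Q\<rfloor>..\<lfloor>Q\<rfloor>}"
      by (auto simp: coeffs_def abs_le_iff minus_le_iff split: if_splits)
    moreover have "length (coeffs P) \<le> Suc n"
      using that by (simp add: coeffs_def polys_bounded_def)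
    ultimately show ?thesis by (intro image_eqI[of _ _ "coeffs P"]) (auto simp: X_def)
  qed
  moreover have "finite X" unfolding X_def by (intro finite_lists_length_le) auto
  ultimately show ?thesis by (meson finite_imageI finite_subset subsetI)
qed

text \<open>\<open>card\<close> of an infinite set is 0, so lower bounds for the count rest on
  finiteness. Both coordinates are roots of one of finitely many nonzero polynomials.\<close>

lemma finite_algebraic_points: "finite (algebraic_points n Q)"
proof -
  define Z where "Z P = {x. eval_real P x = 0}" for P
  have "finite (Z P)" if "P \<noteq> 0" for P
  proof -
    have "map_poly real_of_int P \<noteq> 0" using that by (simp add: map_poly_eq_0_iff)
    then show ?thesis unfolding Z_def eval_real_def by (rule poly_roots_finite)
  qed
  then have "finite (\<Union>P\<in>polys_bounded n Q - {0}. Z P \<times> Z P)"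
    using finite_polys_bounded by auto
  moreover have "algebraic_points n Q \<subseteq> (\<Union>P\<in>polys_bounded n Q - {0}. Z P \<times> Z P)"
  proof
    fix \<alpha> assume \<alpha>: "\<alpha> \<in> algebraic_points n Q"
    then have "is_min_poly (min_poly \<alpha>) \<alpha>"
      using is_min_poly_exists unfolding min_poly_def algebraic_points_def by (metis (mono_tags, lifting) mem_Collect_eq someI_ex)
    then have "min_poly \<alpha> \<in> polys_bounded n Q - {0}" "\<alpha> \<in> Z (min_poly \<alpha>) \<times> Z (min_poly \<alpha>)"
      using \<alpha> by (auto simp: algebraic_points_def polys_bounded_def point_degree_def point_height_def
          is_min_poly_def vanishes_at_def Z_def mem_Times_iff)
    then show "\<alpha> \<in> (\<Union>P\<in>polys_bounded n Q - {0}. Z P \<times> Z P)" by blast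
  qed
  ultimately show ?thesis by (rule finite_subset[rotated])
qed

section \<open>Multiples of \<open>k\<close> in progressions, and sums over \<open>k\<close>\<close>

lemma card_dvd_affine_le:
  fixes c x k :: int
  assumes "k \<ge> 1"
  shows "real (card {v\<in>{x..<x + int m}. k dvd 4 * v + c}) \<le> 4 * real m / of_int k + 2"
proof -
  define X where "X = {v\<in>{x..<x + int m}. k dvd 4 * v + c}"
  \<comment> \<open>The exact quotients are distinct integers in an interval of length about
    \<open>4 * m / k\<close>. Of the additive 2, one unit counts the endpoint and one pays for
    rounding.\<close>
  have "inj_on (\<lambda>v. (4 * v + c) div k) X"
    using assms by (auto simp: inj_on_def X_def dvd_def)
  moreover have "(\<lambda>v. (4 * v + c) div k) ` X \<subseteq> {(4 * x + c) div k..(4 * x + c + 4 * int m) div k}"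
    using assms by (auto simp: X_def intro!: zdiv_mono1)
  ultimately have "card X \<le> card {(4 * x + c) div k..(4 * x + c + 4 * int m) div k}"
    by (meson card_inj_on_le finite_atLeastAtMost_int)
  then have "real (card X) \<le> real_of_int ((4 * x + c + 4 * int m) div k) - of_int ((4 * x + c) div k) + 1"
    using zdiv_mono1[of "4 * x + c" "4 * x + c + 4 * int m" k] assms by (simp add: of_nat_diff)
  moreover have "real_of_int ((4 * x + c + 4 * int m) div k) \<le> (4 * x + c + 4 * real m) / k"
    using floor_divide_of_int_eq[where ?'a=real, of "4 * x + c + 4 * int m" k]
      of_int_floor_le[of "real_of_int (4 * x + c + 4 * int m) / real_of_int k"] by simp
  moreover have "real_of_int ((4 * x + c) div k) \<ge> (4 * x + c) / k - 1"
    using floor_divide_of_int_eq[where ?'a=real, of "4 * x + c" k] by linarith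
  ultimately show ?thesis unfolding X_def by (simp add: add_divide_distrib)
qed

text \<open>A square root instead of a logarithm is enough for the later comparison with
  \<open>m\<^sup>2\<close>. Each term is at most the increment of \<open>2 * sqrt N\<close>.\<close>

lemma sum_inverse_le_sqrt: "(\<Sum>k = 1..N. 1 / real k) \<le> 2 * sqrt (real N)"
proof (induction N)
  case (Suc N)
  define r where "r = sqrt (real N)"
  define t where "t = sqrt (real (Suc N))"
  have sq: "r\<^sup>2 = real N" "t\<^sup>2 = real N + 1" by (simp_all add: r_def t_def)
  have "r \<ge> 0" "t \<ge> 1" "r \<le> t" by (simp_all add: r_def t_def)
  have "1 = (t - r) * (t + r)" using sq by (simp add: algebra_simps power2_eq_square)
  also have "\<dots> \<le> (t - r) * (2 * t)" using \<open>r \<le> t\<close> by (intro mult_left_mono) auto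
  also have "\<dots> \<le> (t - r) * (2 * t\<^sup>2)"
    using \<open>t \<ge> 1\<close> \<open>r \<le> t\<close> by (intro mult_left_mono) (auto simp: power2_eq_square)
  finally have "1 / real (Suc N) \<le> 2 * t - 2 * r"
    using sq by (simp add: divide_simps) (simp add: algebra_simps)
  then show ?case using Suc by (simp add: r_def t_def)
qed auto

text \<open>Telescoping: \<open>1 / (N + 1)\<^sup>2 \<le> 1 / N - 1 / (N + 1)\<close>.\<close>

lemma sum_inverse_squares_le:
  assumes "M \<ge> 1"
  shows "(\<Sum>k = Suc M..N. 1 / (real k)\<^sup>2) \<le> 1 / real M"
proof -
  have "(\<Sum>k = Suc M..N. 1 / (real k)\<^sup>2) \<le> 1 / real M - 1 / real N" if "N \<ge> M"
    using that
  proof (induction N rule: dec_induct)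
    case (step N)
    have "1 / (real (Suc N))\<^sup>2 \<le> 1 / real N - 1 / real (Suc N)"
      using step assms by (simp add: divide_simps power2_eq_square)
    then show ?case using step by simp
  qed auto
  then show ?thesis using assms by (cases "N \<ge> M") (auto intro: order_trans)
qed

section \<open>A family of Eisenstein polynomials\<close>

text \<open>\<open>N\<close> is the range of the free part of the high coefficients,
  \<open>m\<close> that of the two low ones, and \<open>W\<close> weights the quadratic coefficient.
  \<open>p\<close> and \<open>q\<close> say where the windows for the low coefficients start,
  depending on the high ones; the counting holds for every choice, and the root construction fixes
  one.\<close>

locale eisenstein_family =
  fixes n W N m :: nat and p q :: "(nat \<Rightarrow> int) \<Rightarrow> int"
  assumes n: "n \<ge> 2" and N: "N \<ge> 1"
begin

text \<open>Functions are extensional, so a parameter is determined by its values on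
  \<open>{2..n}\<close>, that is, by the coefficients it produces.\<close>

definition params :: "((nat \<Rightarrow> int) \<times> int \<times> int) set" where
  "params = ({2..n} \<rightarrow>\<^sub>E {1..int N}) \<times> {0..<int m} \<times> {0..<int m}"

text \<open>Makes \<open>fam \<tau> \<equiv> t\<^sup>n + 2\<close> modulo 4 and lets the quadratic coefficient dominate the higher ones.\<close>

definition shift :: "nat \<Rightarrow> int" where
  "shift l = (if l = 2 then 4 * int (W * N) else 0) + (if l = n then 1 else 0)"

definition high :: "(nat \<Rightarrow> int) \<Rightarrow> nat \<Rightarrow> int" where
  "high b l = 4 * b l + shift l"

fun coef :: "(nat \<Rightarrow> int) \<times> int \<times> int \<Rightarrow> nat \<Rightarrow> int" where
  "coef (b, i, j) l =
    (if l = 0 then 4 * (q b + j) + 2 else if l = 1 then 4 * (p b + i) else high b l)"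

definition fam :: "(nat \<Rightarrow> int) \<times> int \<times> int \<Rightarrow> int poly" where
  "fam \<tau> = (\<Sum>l\<le>n. monom (coef \<tau> l) l)"

lemma coeff_fam: "coeff (fam \<tau>) l = (if l \<le> n then coef \<tau> l else 0)"
  by (simp add: fam_def coeff_sum)

lemma finite_params: "finite params"
  unfolding params_def by (intro finite_cartesian_product finite_PiE) auto

lemma card_params: "card params = N ^ (n - 1) * m\<^sup>2"
  using n by (simp add: params_def card_cartesian_product card_PiE power2_eq_square)

lemma high_bounds:
  assumes "b \<in> {2..n} \<rightarrow>\<^sub>E {1..int N}" and "l \<in> {2..n}"
  shows "4 \<le> high b l" "high b l \<le> (4 * int W + 5) * int N"
    and "l \<noteq> 2 \<Longrightarrow> high b l \<le> 5 * int N" and "4 * int W * int N \<le> high b 2"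
proof -
  define w where "w = int W * int N"
  have w: "0 \<le> w" and shift: "shift l' = (if l' = 2 then 4 * w else 0) + (if l' = n then 1 else 0)" for l'
    by (simp_all add: w_def shift_def)
  have b: "1 \<le> b l" "b l \<le> int N" "1 \<le> b 2" using assms by (auto simp: PiE_iff)
  have N': "1 \<le> int N" using N by simp
  show "4 \<le> high b l"
    unfolding high_def shift using b w by (cases "l = 2"; cases "l = n") simp_all
  have "high b l \<le> 4 * w + 5 * int N"
    unfolding high_def shift using b w N' by (cases "l = 2"; cases "l = n") simp_all
  then show "high b l \<le> (4 * int W + 5) * int N" by (simp add: w_def algebra_simps)
  show "high b l \<le> 5 * int N" if "l \<noteq> 2"
    unfolding high_def shift using b N' that by (cases "l = n") simp_all
  have "4 * w \<le> high b 2" unfolding high_def shift using b by (cases "2 = n") simp_all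
  then show "4 * int W * int N \<le> high b 2" by (simp add: w_def)
qed

lemma
  assumes "\<tau> \<in> params"
  shows degree_fam: "degree (fam \<tau>) = n"
    and odd_coeff_fam: "odd (coeff (fam \<tau>) n)"
    and even_coeff_fam: "\<And>l. l < n \<Longrightarrow> even (coeff (fam \<tau>) l)"
    and coeff_0_fam: "\<not> 4 dvd coeff (fam \<tau>) 0"
proof -
  obtain b i j where \<tau>: "\<tau> = (b, i, j)" by (metis prod.exhaust)
  show o: "odd (coeff (fam \<tau>) n)"
    using n by (auto simp: coeff_fam \<tau> high_def shift_def)
  show "degree (fam \<tau>) = n"
  proof (rule antisym)
    show "degree (fam \<tau>) \<le> n" by (rule degree_le) (simp add: coeff_fam)
    show "n \<le> degree (fam \<tau>)" using o by (intro le_degree) auto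
  qed
  show "even (coeff (fam \<tau>) l)" if "l < n" for l
    using that by (auto simp: coeff_fam \<tau> high_def shift_def)
  show "\<not> 4 dvd coeff (fam \<tau>) 0"
    unfolding coeff_fam \<tau> by (simp, presburger)
qed

lemma inj_on_fam: "inj_on fam params"
proof (rule inj_onI)
  fix \<tau> \<tau>' assume in_params: "\<tau> \<in> params" "\<tau>' \<in> params" and eq: "fam \<tau> = fam \<tau>'"
  obtain b i j b' i' j' where \<tau>: "\<tau> = (b, i, j)" "\<tau>' = (b', i', j')" by (metis prod.exhaust)
  have coef: "coef \<tau> l = coef \<tau>' l" if "l \<le> n" for l
    using arg_cong[OF eq, of "\<lambda>P. coeff P l"] that by (simp add: coeff_fam)
  have "b l = b' l" if "l \<in> {2..n}" for l
    using coef[of l] that by (simp add: \<tau> high_def)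
  moreover have "b \<in> {2..n} \<rightarrow>\<^sub>E {1..int N}" "b' \<in> {2..n} \<rightarrow>\<^sub>E {1..int N}"
    using in_params \<tau> by (simp_all add: params_def)
  ultimately have "b = b'" by (metis PiE_ext)
  with coef[of 0] coef[of 1] n \<tau> show "\<tau> = \<tau>'" by simp
qed

section \<open>Members of the family whose coefficients share a large divisor\<close>

lemma card_common_divisor_le:
  assumes "1 \<le> k" "k \<le> (4 * W + 5) * N"
  shows "real (card {\<tau> \<in> params. \<forall>l\<le>n. int k dvd coef \<tau> l})
    \<le> ((8 * real W + 14) * real N / real k) ^ (n - 1) * (4 * real m / real k + 2)\<^sup>2"
proof -
  have k1: "1 \<le> int k" using assms(1) by simp
  \<comment> \<open>The divisibility conditions decouple: each high value is restricted on its own,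
    then \<open>i\<close> and \<open>j\<close> for fixed \<open>b\<close>, with bounds that do not
    depend on the window starts.\<close>
  define V where "V l = {v\<in>{1..<1 + int N}. int k dvd 4 * v + shift l}" for l
  define X where "X b = {i\<in>{0..<0 + int m}. int k dvd 4 * i + 4 * p b}" for b
  define Y where "Y b = {j\<in>{0..<0 + int m}. int k dvd 4 * j + (4 * q b + 2)}" for b
  have fin: "finite (V l)" "finite (X b)" "finite (Y b)" for l b
    unfolding V_def X_def Y_def by (rule finite_Collect_conjI, rule disjI1, simp)+
  have finP: "finite (PiE {2..n} V)" using fin by (intro finite_PiE) auto
  have VXY: "real (card (V l)) \<le> 4 * real N / real k + 2" "real (card (X b)) \<le> 4 * real m / real k + 2"
    "real (card (Y b)) \<le> 4 * real m / real k + 2" for l b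
    using card_dvd_affine_le[of "int k" 1 N "shift l"] card_dvd_affine_le[of "int k" 0 m "4 * p b"]
      card_dvd_affine_le[of "int k" 0 m "4 * q b + 2"] k1
    unfolding V_def X_def Y_def by (simp_all only: of_int_of_nat_eq simp_thms)
  have "{\<tau> \<in> params. \<forall>l\<le>n. int k dvd coef \<tau> l} \<subseteq> (SIGMA b:PiE {2..n} V. X b \<times> Y b)"
  proof
    fix \<tau> assume \<tau>: "\<tau> \<in> {\<tau> \<in> params. \<forall>l\<le>n. int k dvd coef \<tau> l}"
    obtain b i j where bij: "\<tau> = (b, i, j)" by (metis prod.exhaust)
    have dvd: "int k dvd coef (b, i, j) l" if "l \<le> n" for l using \<tau> that bij by simp
    have b: "b \<in> {2..n} \<rightarrow>\<^sub>E {1..int N}" and ij: "i \<in> {0..<int m}" "j \<in> {0..<int m}"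
      using \<tau> by (auto simp: params_def bij)
    have "b l \<in> V l" if "l \<in> {2..n}" for l
      using PiE_mem[OF b that] dvd[of l] that by (auto simp: V_def high_def)
    then have "b \<in> PiE {2..n} V" using b by (auto simp: PiE_iff)
    moreover have "i \<in> X b" "j \<in> Y b"
      using dvd[of 1] dvd[of 0] n ij by (auto simp: X_def Y_def algebra_simps)
    ultimately show "\<tau> \<in> (SIGMA b:PiE {2..n} V. X b \<times> Y b)" by (simp add: bij)
  qed
  then have "card {\<tau> \<in> params. \<forall>l\<le>n. int k dvd coef \<tau> l} \<le> card (SIGMA b:PiE {2..n} V. X b \<times> Y b)"
    using fin finP by (intro card_mono finite_SigmaI) auto
  also have "\<dots> = (\<Sum>b\<in>PiE {2..n} V. card (X b) * card (Y b))"
    using fin finP by (simp add: card_cartesian_product)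
  finally have "real (card {\<tau> \<in> params. \<forall>l\<le>n. int k dvd coef \<tau> l})
      \<le> (\<Sum>b\<in>PiE {2..n} V. real (card (X b)) * real (card (Y b)))"
    by (simp flip: of_nat_mult of_nat_sum)
  also have "\<dots> \<le> (\<Sum>b\<in>PiE {2..n} V. (4 * real m / real k + 2)\<^sup>2)"
    unfolding power2_eq_square by (intro sum_mono mult_mono VXY) auto
  also have "\<dots> = (\<Prod>l\<in>{2..n}. real (card (V l))) * (4 * real m / real k + 2)\<^sup>2"
    by (simp add: card_PiE)
  also have "(\<Prod>l\<in>{2..n}. real (card (V l))) \<le> (\<Prod>l\<in>{2..n}. (8 * real W + 14) * real N / real k)"
  proof (intro prod_mono conjI)
    \<comment> \<open>The bound on \<open>k\<close> gives
      \<open>2 \<le> 2 * (4 * W + 5) * N / k\<close>, which absorbs the additive 2; hence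
      \<open>8 * W + 14 = 4 + 2 * (4 * W + 5)\<close>. The factors with \<open>m\<close> keep their
      2, because \<open>m\<close> may be smaller than \<open>k\<close>.\<close>
    have "real k \<le> real ((4 * W + 5) * N)" using assms(2) by (simp only: of_nat_le_iff)
    then have "4 * real N / real k + 2 \<le> (8 * real W + 14) * real N / real k"
      using assms(1) by (simp add: divide_simps) (simp add: algebra_simps)
    then show "real (card (V l)) \<le> (8 * real W + 14) * real N / real k" for l
      using VXY(1)[of l] by linarith
  qed auto
  also have "\<dots> = ((8 * real W + 14) * real N / real k) ^ (n - 1)" by simp
  finally show ?thesis by (simp add: mult_right_mono)
qed

text \<open>A common divisor divides the positive quadratic coefficient, so it is at most
  \<open>(4 * W + 5) * N\<close> and a finite union bound applies. The terms in
  \<open>1 / k\<^sup>2\<close> sum to the \<open>1 / M\<close> part, those in \<open>1 / k\<close>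
  to the square root.\<close>

lemma card_large_content_le:
  assumes "M \<ge> 1"
  shows "real (card {\<tau> \<in> params. \<exists>k>M. \<forall>l\<le>n. int k dvd coef \<tau> l})
    \<le> ((8 * real W + 14) * real N) ^ (n - 1)
        * (32 * (real m)\<^sup>2 / real M + 16 * sqrt (real ((4 * W + 5) * N)))"
proof -
  define K where "K = (4 * W + 5) * N"
  define A where "A = ((8 * real W + 14) * real N) ^ (n - 1)"
  define D where "D k = {\<tau> \<in> params. \<forall>l\<le>n. int k dvd coef \<tau> l}" for k
  have "A \<ge> 0" by (simp add: A_def)
  have finD: "finite (D k)" for k by (simp add: D_def finite_params)
  have "{\<tau> \<in> params. \<exists>k>M. \<forall>l\<le>n. int k dvd coef \<tau> l} \<subseteq> (\<Union>k\<in>{Suc M..K}. D k)"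
  proof
    fix \<tau> assume "\<tau> \<in> {\<tau> \<in> params. \<exists>k>M. \<forall>l\<le>n. int k dvd coef \<tau> l}"
    then obtain k where k: "k > M" "\<tau> \<in> D k" by (auto simp: D_def)
    obtain b i j where bij: "\<tau> = (b, i, j)" by (metis prod.exhaust)
    have b: "b \<in> {2..n} \<rightarrow>\<^sub>E {1..int N}" using k by (auto simp: D_def params_def bij)
    have "int k dvd coef (b, i, j) 2" using k n by (auto simp: D_def bij)
    then have "int k dvd high b 2" by simp
    then have "int k \<le> high b 2" using high_bounds(1)[OF b, of 2] n by (intro zdvd_imp_le) auto
    also have "\<dots> \<le> int K" using high_bounds(2)[OF b, of 2] n by (simp add: K_def algebra_simps)
    finally show "\<tau> \<in> (\<Union>k\<in>{Suc M..K}. D k)" using k by auto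
  qed
  then have "card {\<tau> \<in> params. \<exists>k>M. \<forall>l\<le>n. int k dvd coef \<tau> l} \<le> card (\<Union>k\<in>{Suc M..K}. D k)"
    using finD by (intro card_mono) auto
  also have "\<dots> \<le> (\<Sum>k\<in>{Suc M..K}. card (D k))" by (intro card_UN_le) auto
  finally have "real (card {\<tau> \<in> params. \<exists>k>M. \<forall>l\<le>n. int k dvd coef \<tau> l})
      \<le> (\<Sum>k\<in>{Suc M..K}. real (card (D k)))"
    by (simp flip: of_nat_sum)
  also have "\<dots> \<le> (\<Sum>k\<in>{Suc M..K}. A * (32 * (real m)\<^sup>2 * (1 / (real k)\<^sup>2) + 8 * (1 / real k)))"
  proof (rule sum_mono)
    fix k assume k: "k \<in> {Suc M..K}"
    define r where "r = 1 / real k"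
    have r: "0 \<le> r" "r \<le> 1" using k by (auto simp: r_def)
    have "real (card (D k)) \<le> ((8 * real W + 14) * real N / real k) ^ (n - 1) * (4 * real m / real k + 2)\<^sup>2"
      unfolding D_def using k by (intro card_common_divisor_le) (auto simp: K_def)
    also have "\<dots> = A * (r ^ (n - 1) * (4 * real m * r + 2)\<^sup>2)"
      by (simp add: A_def r_def power_divide)
    also have "\<dots> \<le> A * (r * (32 * (real m)\<^sup>2 * r\<^sup>2 + 8))"
    proof (intro mult_left_mono mult_mono)
      \<comment> \<open>As \<open>n \<ge> 2\<close>, at least one factor \<open>1 / k\<close> is
        left to multiply the constant 8.\<close>
      show "r ^ (n - 1) \<le> r" using power_decreasing[of 1 "n - 1" r] r n by simp
      \<comment> \<open>With \<open>u = 4 * m * r\<close> this is the inequality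
        \<open>(u + 2)\<^sup>2 \<le> 2 * u\<^sup>2 + 8\<close>.\<close>
      have "0 \<le> (4 * real m * r - 2)\<^sup>2" by simp
      then show "(4 * real m * r + 2)\<^sup>2 \<le> 32 * (real m)\<^sup>2 * r\<^sup>2 + 8"
        by (simp add: power2_eq_square algebra_simps)
    qed (use r \<open>A \<ge> 0\<close> in auto)
    also have "\<dots> \<le> A * (32 * (real m)\<^sup>2 * r\<^sup>2 + 8 * r)"
    proof (rule mult_left_mono)
      have "r * (32 * (real m)\<^sup>2 * r\<^sup>2) \<le> 1 * (32 * (real m)\<^sup>2 * r\<^sup>2)"
        using r by (intro mult_right_mono) auto
      then show "r * (32 * (real m)\<^sup>2 * r\<^sup>2 + 8) \<le> 32 * (real m)\<^sup>2 * r\<^sup>2 + 8 * r"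
        by (simp add: algebra_simps)
    qed (fact \<open>A \<ge> 0\<close>)
    finally show "real (card (D k)) \<le> A * (32 * (real m)\<^sup>2 * (1 / (real k)\<^sup>2) + 8 * (1 / real k))"
      by (simp add: r_def power_divide)
  qed
  also have "\<dots> = A * (32 * (real m)\<^sup>2 * (\<Sum>k\<in>{Suc M..K}. 1 / (real k)\<^sup>2) + 8 * (\<Sum>k\<in>{Suc M..K}. 1 / real k))"
    by (simp only: sum.distrib flip: sum_distrib_left)
  also have "\<dots> \<le> A * (32 * (real m)\<^sup>2 * (1 / real M) + 8 * (2 * sqrt (real K)))"
  proof (intro mult_left_mono add_mono)
    have "(\<Sum>k\<in>{Suc M..K}. 1 / real k) \<le> (\<Sum>k\<in>{1..K}. 1 / real k)"
      by (intro sum_mono2) auto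
    then show "(\<Sum>k\<in>{Suc M..K}. 1 / real k) \<le> 2 * sqrt (real K)"
      using sum_inverse_le_sqrt[of K] by linarith
  qed (use sum_inverse_squares_le[OF assms] \<open>A \<ge> 0\<close> in auto)
  finally show ?thesis by (simp add: A_def K_def)
qed

text \<open>A pair of a point and a multiplier \<open>c\<close> recovers the polynomial, and
  \<open>c\<close> takes at most \<open>2 * M + 1\<close> values on good members. Assumption
  \<open>large\<close> makes at most half of the family bad; \<open>root\<close> and
  \<open>height\<close> isolate the analysis.\<close>

lemma card_algebraic_points_ge:
  assumes "M \<ge> 1"
    and root: "\<And>\<tau>. \<tau> \<in> params \<Longrightarrow> \<exists>\<alpha>\<in>S. vanishes_at (fam \<tau>) \<alpha>"
    and height: "\<And>\<tau> l. \<tau> \<in> params \<Longrightarrow> l \<le> n \<Longrightarrow> \<bar>real_of_int (coef \<tau> l)\<bar> \<le> Q"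
    and large: "((8 * real W + 14) * real N) ^ (n - 1)
        * (32 * (real m)\<^sup>2 / real M + 16 * sqrt (real ((4 * W + 5) * N))) \<le> real N ^ (n - 1) * (real m)\<^sup>2 / 2"
  shows "real N ^ (n - 1) * (real m)\<^sup>2 / 2 \<le> (2 * real M + 1) * real (card (algebraic_points_in n Q S))"
proof -
  define good where "good = {\<tau> \<in> params. \<not> (\<exists>k>M. \<forall>l\<le>n. int k dvd coef \<tau> l)}"
  define bad where "bad = {\<tau> \<in> params. \<exists>k>M. \<forall>l\<le>n. int k dvd coef \<tau> l}"
  have "params = good \<union> bad" "good \<inter> bad = {}" by (auto simp: good_def bad_def)
  then have "card params = card good + card bad"
    using finite_params by (metis card_Un_disjoint finite_Un)
  then have "real N ^ (n - 1) * (real m)\<^sup>2 = real (card good) + real (card bad)"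
    using card_params by (metis of_nat_add of_nat_mult of_nat_power)
  then have good: "real N ^ (n - 1) * (real m)\<^sup>2 / 2 \<le> real (card good)"
    using card_large_content_le[OF \<open>M \<ge> 1\<close>] large unfolding bad_def by linarith
  have ex: "\<exists>\<alpha> c. \<alpha> \<in> algebraic_points_in n Q S \<and> \<bar>c\<bar> \<le> int M \<and> fam \<tau> = smult c (min_poly \<alpha>)"
    if "\<tau> \<in> good" for \<tau>
  proof -
    have \<tau>: "\<tau> \<in> params" using that by (simp add: good_def)
    obtain \<alpha> where \<alpha>: "\<alpha> \<in> S" "vanishes_at (fam \<tau>) \<alpha>" using root[OF \<tau>] by blast
    obtain c where c: "c \<noteq> 0" "fam \<tau> = smult c (min_poly \<alpha>)" "algebraic_point \<alpha>"
    proof (rule eisenstein_two_smult_min_poly)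
      show "degree (fam \<tau>) = n" "odd (coeff (fam \<tau>) n)" "\<not> 4 dvd coeff (fam \<tau>) 0" "n \<ge> 1"
        using degree_fam[OF \<tau>] odd_coeff_fam[OF \<tau>] coeff_0_fam[OF \<tau>] n by simp_all
      show "even (coeff (fam \<tau>) l)" if "l < n" for l using even_coeff_fam[OF \<tau> that] .
      show "vanishes_at (fam \<tau>) \<alpha>" by (fact \<alpha>(2))
    qed
    have coef: "coef \<tau> l = c * coeff (min_poly \<alpha>) l" if "l \<le> n" for l
      using arg_cong[OF c(2), of "\<lambda>P. coeff P l"] that by (simp add: coeff_fam)
    \<comment> \<open>The absolute value of \<open>c\<close> is itself a common divisor, so on a
      good member it cannot exceed \<open>M\<close>.\<close>
    then have "\<forall>l\<le>n. int (nat \<bar>c\<bar>) dvd coef \<tau> l" by simp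
    then have "nat \<bar>c\<bar> \<le> M" using that not_le unfolding good_def by blast
    moreover have deg: "degree (min_poly \<alpha>) = n"
      using degree_fam[OF \<tau>] c by simp
    moreover have "real_of_int (poly_height (min_poly \<alpha>)) \<le> Q"
      unfolding poly_height_le_iff deg
    proof (intro allI impI)
      fix l assume l: "l \<le> n"
      \<comment> \<open>Dividing by a nonzero integer does not enlarge coefficients, so the height
        bound passes to the minimal polynomial.\<close>
      have "\<bar>coeff (min_poly \<alpha>) l\<bar> \<le> \<bar>coef \<tau> l\<bar>"
        using coef[OF l] c(1) mult_right_mono[of 1 "\<bar>c\<bar>" "\<bar>coeff (min_poly \<alpha>) l\<bar>"] by (simp add: abs_mult)
      then have "\<bar>real_of_int (coeff (min_poly \<alpha>) l)\<bar> \<le> \<bar>real_of_int (coef \<tau> l)\<bar>" by linarith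
      then show "\<bar>real_of_int (coeff (min_poly \<alpha>) l)\<bar> \<le> Q" using height[OF \<tau> l] by linarith
    qed
    ultimately have "\<alpha> \<in> algebraic_points_in n Q S \<and> \<bar>c\<bar> \<le> int M \<and> fam \<tau> = smult c (min_poly \<alpha>)"
      using \<alpha>(1) c by (simp add: algebraic_points_in_def algebraic_points_def point_degree_def point_height_def)
    then show ?thesis by blast
  qed
  then obtain \<alpha> c where \<alpha>c: "\<And>\<tau>. \<tau> \<in> good \<Longrightarrow> \<alpha> \<tau> \<in> algebraic_points_in n Q S \<and> \<bar>c \<tau>\<bar> \<le> int M
      \<and> fam \<tau> = smult (c \<tau>) (min_poly (\<alpha> \<tau>))" by metis
  have "inj_on (\<lambda>\<tau>. (\<alpha> \<tau>, c \<tau>)) good"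
  proof (rule inj_onI)
    fix \<tau> \<tau>' assume g: "\<tau> \<in> good" "\<tau>' \<in> good" and "(\<alpha> \<tau>, c \<tau>) = (\<alpha> \<tau>', c \<tau>')"
    then have "fam \<tau> = fam \<tau>'" using \<alpha>c by simp
    then show "\<tau> = \<tau>'" using inj_on_fam g by (auto simp: good_def inj_on_def)
  qed
  moreover have "(\<lambda>\<tau>. (\<alpha> \<tau>, c \<tau>)) ` good \<subseteq> algebraic_points_in n Q S \<times> {- int M..int M}"
    using \<alpha>c by (fastforce simp: abs_le_iff)
  moreover have "finite (algebraic_points_in n Q S)"
    unfolding algebraic_points_in_def using finite_algebraic_points by blast
  ultimately have "card good \<le> card (algebraic_points_in n Q S \<times> {- int M..int M})"
    by (intro card_inj_on_le) auto
  also have "\<dots> = card (algebraic_points_in n Q S) * (2 * M + 1)"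
    by (simp add: card_cartesian_product nat_add_distrib nat_mult_distrib)
  finally have "real (card good) \<le> real (card (algebraic_points_in n Q S) * (2 * M + 1))"
    by (simp only: of_nat_le_iff)
  then show ?thesis using good by (simp add: algebra_simps)
qed

end

section \<open>Roots close to the centre of the square\<close>

text \<open>Division with remainder by \<open>(t - x) * (t - y)\<close>, the quotient recorded as a
  continuous function, hence bounded on bounded sets. For \<open>l = 2\<close> it is pinned to 1,
  the value that the dominance of the quadratic coefficient relies on.\<close>

lemma power_mod_quadratic:
  fixes x y :: real
  shows "\<exists>S \<alpha> \<beta>. (\<forall>t. t ^ l = (t - x) * (t - y) * S t + \<alpha> * t + \<beta>) \<and> continuous_on UNIV S \<and>
    (l = 2 \<longrightarrow> S = (\<lambda>_. 1))"
proof (cases "l = 2")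
  case True
  have "t ^ l = (t - x) * (t - y) * 1 + (x + y) * t + (- x * y)" for t
    using True by (simp add: algebra_simps power2_eq_square)
  then show ?thesis by (intro exI[of _ "\<lambda>_. 1"] exI[of _ "x + y"] exI[of _ "- x * y"]) auto
next
  case False
  have "\<exists>S \<alpha> \<beta>. (\<forall>t. t ^ l = (t - x) * (t - y) * S t + \<alpha> * t + \<beta>) \<and> continuous_on UNIV S"
  proof (induction l)
    case 0
    show ?case by (intro exI[of _ "\<lambda>_. 0"] exI[of _ 0] exI[of _ 1]) auto
  next
    case (Suc l)
    then obtain S \<alpha> \<beta> where S: "\<And>t. t ^ l = (t - x) * (t - y) * S t + \<alpha> * t + \<beta>" "continuous_on UNIV S"
      by blast
    \<comment> \<open>Multiplying by \<open>t\<close> creates \<open>\<alpha> * t\<^sup>2\<close>,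
      reduced by \<open>t\<^sup>2 = (t - x) * (t - y) + (x + y) * t - x * y\<close>.\<close>
    have "t ^ Suc l = (t - x) * (t - y) * (t * S t + \<alpha>) + (\<alpha> * (x + y) + \<beta>) * t + (- \<alpha> * x * y)" for t
      unfolding power_Suc S(1) by (simp add: algebra_simps)
    moreover have "continuous_on UNIV (\<lambda>t. t * S t + \<alpha>)" using S(2) by (intro continuous_intros)
    ultimately show ?case by (intro exI[of _ "\<lambda>t. t * S t + \<alpha>"]) blast
  qed
  then show ?thesis using False by blast
qed

lemma powers_mod_quadratic_bounded:
  fixes x y R :: real
  obtains S :: "nat \<Rightarrow> real \<Rightarrow> real" and \<alpha> \<beta> :: "nat \<Rightarrow> real" and B :: real
  where "\<And>l t. t ^ l = (t - x) * (t - y) * S l t + \<alpha> l * t + \<beta> l" and "\<And>t. S 2 t = 1"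
    and "\<And>l t. l \<le> n \<Longrightarrow> \<bar>t\<bar> \<le> R \<Longrightarrow> \<bar>S l t\<bar> \<le> B"
    and "\<And>l. l \<le> n \<Longrightarrow> \<bar>\<alpha> l\<bar> \<le> B" "\<And>l. l \<le> n \<Longrightarrow> \<bar>\<beta> l\<bar> \<le> B"
    and "B \<ge> R + 1" "B \<ge> 1"
proof -
  obtain S :: "nat \<Rightarrow> real \<Rightarrow> real" and \<alpha> \<beta> :: "nat \<Rightarrow> real"
    where S: "\<And>l t. t ^ l = (t - x) * (t - y) * S l t + \<alpha> l * t + \<beta> l"
      "\<And>l. continuous_on UNIV (S l)" "\<And>t. S 2 t = 1"
    using power_mod_quadratic[of _ x y] by metis
  have "\<exists>c. \<forall>t. \<bar>t\<bar> \<le> R \<longrightarrow> \<bar>S l t\<bar> \<le> c" for l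
  proof -
    have "compact (S l ` {-R..R})"
      using S(2) by (intro compact_continuous_image) (auto intro: continuous_on_subset)
    then obtain c where "\<forall>v\<in>S l ` {-R..R}. norm v \<le> c" using compact_imp_bounded bounded_iff by metis
    then show ?thesis by (intro exI[of _ c]) (auto simp: abs_le_iff)
  qed
  then obtain c where c: "\<And>l t. \<bar>t\<bar> \<le> R \<Longrightarrow> \<bar>S l t\<bar> \<le> c l" by metis
  \<comment> \<open>The summand \<open>1 + \<bar>R\<bar>\<close> lets the same \<open>B\<close>
    control a linear polynomial on \<open>\<bar>t\<bar> \<le> R\<close>.\<close>
  define B where "B = 1 + \<bar>R\<bar> + (\<Sum>l\<le>n. \<bar>c l\<bar> + \<bar>\<alpha> l\<bar> + \<bar>\<beta> l\<bar>)"
  have nn: "(\<Sum>l\<le>n. \<bar>c l\<bar> + \<bar>\<alpha> l\<bar> + \<bar>\<beta> l\<bar>) \<ge> 0" by (intro sum_nonneg) auto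
  have B: "\<bar>c l\<bar> + \<bar>\<alpha> l\<bar> + \<bar>\<beta> l\<bar> \<le> B" if "l \<le> n" for l
    using member_le_sum[of l "{..n}" "\<lambda>l. \<bar>c l\<bar> + \<bar>\<alpha> l\<bar> + \<bar>\<beta> l\<bar>"] that by (simp add: B_def)
  show ?thesis
  proof (rule that[of S \<alpha> \<beta> B])
    show "\<bar>S l t\<bar> \<le> B" if "l \<le> n" "\<bar>t\<bar> \<le> R" for l t
      using B[OF that(1)] c[OF that(2), of l] by linarith
    show "\<bar>\<alpha> l\<bar> \<le> B" "\<bar>\<beta> l\<bar> \<le> B" if "l \<le> n" for l
      using B[OF that] by linarith+
    show "B \<ge> R + 1" "B \<ge> 1" using nn by (simp_all add: B_def)
  qed (fact S)+
qed

text \<open>Between \<open>x - h\<close> and \<open>x + h\<close> the factor \<open>t - x\<close>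
  changes sign while \<open>t - y\<close> does not, so the main term has opposite signs at the ends.
  There its size is at least \<open>E\<close>, which exceeds the error, and the intermediate value
  theorem applies.\<close>

lemma perturbed_root:
  fixes x y h G E :: real and f g e :: "real \<Rightarrow> real"
  assumes f: "\<And>t. f t = (t - x) * (t - y) * g t + e t" and cont: "continuous_on UNIV f"
    and h: "0 < h" "4 * h \<le> \<bar>x - y\<bar>"
    and g: "\<And>t. \<bar>t - x\<bar> = h \<Longrightarrow> G \<le> g t" and e: "\<And>t. \<bar>t - x\<bar> = h \<Longrightarrow> \<bar>e t\<bar> < E"
    and G: "G > 0" and E: "E \<le> h * (\<bar>x - y\<bar> / 2) * G"
  obtains r where "\<bar>r - x\<bar> \<le> h" "f r = 0"
proof -
  have big: "E \<le> h * \<bar>t - y\<bar> * g t" if "\<bar>t - x\<bar> = h" for t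
  proof (rule order_trans[OF E], intro mult_mono)
    \<comment> \<open>The distance from \<open>y\<close> drops by at most \<open>h\<close>, a
      quarter of \<open>\<bar>x - y\<bar>\<close>.\<close>
    show "\<bar>x - y\<bar> / 2 \<le> \<bar>t - y\<bar>" 
      using abs_triangle_ineq[of "x - t" "t - y"] abs_minus_commute[of x t] h that by simp
  qed (use h g[OF that] G in auto)
  have cont': "continuous_on {x - h..x + h} f" using cont by (rule continuous_on_subset) simp
  have e': "\<bar>e (x - h)\<bar> < E" "\<bar>e (x + h)\<bar> < E" using e h by auto
  have "\<exists>r. x - h \<le> r \<and> r \<le> x + h \<and> f r = 0"
  proof (cases "x > y")
    case True
    then have "\<bar>x - h - y\<bar> = x - h - y" "\<bar>x + h - y\<bar> = x + h - y" using h by simp_all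
    then have "E \<le> h * (x - h - y) * g (x - h)" "E \<le> h * (x + h - y) * g (x + h)"
      using big[of "x - h"] big[of "x + h"] h(1) by simp_all
    then have "f (x - h) \<le> 0" "0 \<le> f (x + h)"
      using e' unfolding f by simp_all
    then show ?thesis using IVT'[of f "x - h" 0 "x + h"] h cont' by auto
  next
    case False
    then have "\<bar>x - h - y\<bar> = - (x - h - y)" "\<bar>x + h - y\<bar> = - (x + h - y)" using h by simp_all
    then have "E \<le> - (h * (x - h - y) * g (x - h))" "E \<le> - (h * (x + h - y) * g (x + h))"
      using big[of "x - h"] big[of "x + h"] h(1) by (simp_all del: minus_diff_eq)
    then have "0 \<le> f (x - h)" "f (x + h) \<le> 0"
      using e' unfolding f by simp_all
    then show ?thesis using IVT2'[of f "x + h" 0 "x - h"] h cont' by auto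
  qed
  then obtain r where "x - h \<le> r" "r \<le> x + h" "f r = 0" by blast
  then show ?thesis using that[of r] by (simp add: abs_le_iff)
qed

section \<open>Roots and heights within the family\<close>

context eisenstein_family
begin

text \<open>Isolates the linear remainder, whose two coefficients a suitable choice of
  \<open>p\<close> and \<open>q\<close> makes small.\<close>

lemma eval_fam:
  fixes x y t :: real and S :: "nat \<Rightarrow> real \<Rightarrow> real" and \<alpha> \<beta> :: "nat \<Rightarrow> real"
  assumes "\<And>l t. t ^ l = (t - x) * (t - y) * S l t + \<alpha> l * t + \<beta> l"
  shows "eval_real (fam (b, i, j)) t = (t - x) * (t - y) * (\<Sum>l = 2..n. high b l * S l t)
    + (4 * (p b + i) + (\<Sum>l = 2..n. high b l * \<alpha> l)) * t
    + (4 * (q b + j) + 2 + (\<Sum>l = 2..n. high b l * \<beta> l))"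
proof -
  have "degree (fam (b, i, j)) \<le> n" by (rule degree_le) (simp add: coeff_fam)
  then have "eval_real (fam (b, i, j)) t = (\<Sum>l\<le>n. real_of_int (coef (b, i, j) l) * t ^ l)"
    by (simp add: eval_real_altdef coeff_fam)
  also have "{..n} = insert 0 (insert 1 {2..n})" using n by auto
  also have "(\<Sum>l\<in>insert 0 (insert 1 {2..n}). real_of_int (coef (b, i, j) l) * t ^ l)
      = 4 * (q b + j) + 2 + 4 * (p b + i) * t + (\<Sum>l = 2..n. high b l * t ^ l)"
    by simp
  also have "(\<Sum>l = 2..n. high b l * t ^ l) = (\<Sum>l = 2..n. (t - x) * (t - y) * (high b l * S l t)
      + (high b l * \<alpha> l) * t + high b l * \<beta> l)"
    by (intro sum.cong refl, subst assms) (simp add: algebra_simps)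
  also have "\<dots> = (t - x) * (t - y) * (\<Sum>l = 2..n. high b l * S l t)
      + (\<Sum>l = 2..n. high b l * \<alpha> l) * t + (\<Sum>l = 2..n. high b l * \<beta> l)"
    by (simp add: sum.distrib sum_distrib_left sum_distrib_right)
  finally show ?thesis by (simp add: algebra_simps)
qed

lemma sum_high_le:
  fixes u :: "nat \<Rightarrow> real"
  assumes b: "b \<in> {2..n} \<rightarrow>\<^sub>E {1..int N}" and "\<And>l. l \<le> n \<Longrightarrow> \<bar>u l\<bar> \<le> B"
  shows "\<bar>\<Sum>l = 2..n. high b l * u l\<bar> \<le> real n * (4 * real W + 5) * real N * B"
proof -
  have B: "B \<ge> 0" using assms(2)[of 0] by linarith
  have "\<bar>\<Sum>l = 2..n. high b l * u l\<bar> \<le> (\<Sum>l = 2..n. \<bar>high b l * u l\<bar>)" by (rule sum_abs)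
  also have "\<dots> \<le> (\<Sum>l = 2..n. (4 * real W + 5) * real N * B)"
  proof (rule sum_mono)
    fix l assume l: "l \<in> {2..n}"
    have "real_of_int (high b l) \<le> real_of_int ((4 * int W + 5) * int N)"
      using high_bounds(2)[OF b l] by (simp only: of_int_le_iff)
    then show "\<bar>high b l * u l\<bar> \<le> (4 * real W + 5) * real N * B"
      using high_bounds(1)[OF b l] assms(2)[of l] l unfolding abs_mult by (intro mult_mono) auto
  qed
  also have "\<dots> = real (n - 1) * ((4 * real W + 5) * real N * B)" by simp
  also have "\<dots> \<le> real n * ((4 * real W + 5) * real N * B)"
    using B by (intro mult_right_mono) auto
  finally show ?thesis by (simp add: mult.assoc)
qed

text \<open>The quadratic term gives at least \<open>4 * W * N\<close>; the higher ones total at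
  most \<open>5 * n * B * N \<le> W * N\<close> in absolute value. With \<open>u l = S l t\<close>
  this is the positive lower bound that \<open>perturbed_root\<close> asks for.\<close>

lemma sum_high_ge:
  fixes u :: "nat \<Rightarrow> real"
  assumes b: "b \<in> {2..n} \<rightarrow>\<^sub>E {1..int N}" and u: "\<And>l. l \<le> n \<Longrightarrow> \<bar>u l\<bar> \<le> B" and "u 2 = 1"
    and W: "5 * real n * B \<le> real W" "W \<ge> 1"
  shows "real N \<le> (\<Sum>l = 2..n. high b l * u l)"
proof -
  have B: "B \<ge> 0" using u[of 0] by linarith
  have "{2..n} = insert 2 {3..n}" using n by auto
  then have "(\<Sum>l = 2..n. high b l * u l) = high b 2 + (\<Sum>l = 3..n. high b l * u l)"
    using \<open>u 2 = 1\<close> by simp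
  moreover have "real_of_int (4 * int W * int N) \<le> real_of_int (high b 2)"
    using high_bounds(4)[OF b, of 2] n by (simp only: of_int_le_iff) simp
  moreover have "\<bar>\<Sum>l = 3..n. high b l * u l\<bar> \<le> real W * real N"
  proof -
    have "\<bar>\<Sum>l = 3..n. high b l * u l\<bar> \<le> (\<Sum>l = 3..n. \<bar>high b l * u l\<bar>)" by (rule sum_abs)
    also have "\<dots> \<le> (\<Sum>l = 3..n. 5 * real N * B)"
    proof (rule sum_mono)
      fix l assume l: "l \<in> {3..n}"
      then have l': "l \<in> {2..n}" by auto
      have "real_of_int (high b l) \<le> real_of_int (5 * int N)"
        using high_bounds(3)[OF b l'] l by (simp only: of_int_le_iff) simp
      then show "\<bar>high b l * u l\<bar> \<le> 5 * real N * B"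
        using high_bounds(1)[OF b l'] u[of l] l unfolding abs_mult by (intro mult_mono) auto
    qed
    also have "\<dots> = real (n - 2) * (5 * real N * B)" by simp
    also have "\<dots> \<le> real n * (5 * real N * B)" using B by (intro mult_right_mono) auto
    also have "\<dots> = (5 * real n * B) * real N" by simp
    also have "\<dots> \<le> real W * real N" using W by (intro mult_right_mono) auto
    finally show ?thesis .
  qed
  moreover have "real N \<le> real W * real N" using mult_right_mono[of 1 "real W" "real N"] W(2) by simp
  ultimately show ?thesis by simp
qed

lemma card_points_near_ge:
  fixes x y L B Q R :: real and S :: "nat \<Rightarrow> real \<Rightarrow> real" and \<alpha> \<beta> :: "nat \<Rightarrow> real"
  assumes pow: "\<And>l t. t ^ l = (t - x) * (t - y) * S l t + \<alpha> l * t + \<beta> l" and S2: "\<And>t. S 2 t = 1"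
    and S: "\<And>l t. l \<le> n \<Longrightarrow> \<bar>t\<bar> \<le> R \<Longrightarrow> \<bar>S l t\<bar> \<le> B"
    and \<alpha>\<beta>: "\<And>l. l \<le> n \<Longrightarrow> \<bar>\<alpha> l\<bar> \<le> B" "\<And>l. l \<le> n \<Longrightarrow> \<bar>\<beta> l\<bar> \<le> B"
    and B: "B \<ge> R + 1" "B \<ge> 1" and R: "R \<ge> 2 * (\<bar>x\<bar> + \<bar>y\<bar>)"
    and p: "\<And>b. p b = \<lfloor>- (\<Sum>l = 2..n. high b l * \<alpha> l) / 4\<rfloor>"
    and q: "\<And>b. q b = \<lfloor>- (\<Sum>l = 2..n. high b l * \<beta> l) / 4\<rfloor>"
    and W: "5 * real n * B \<le> real W" "W \<ge> 1"
    and L: "0 < L" "L \<le> \<bar>x - y\<bar>"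
    and m: "m \<ge> 1" "real m \<le> L * \<bar>x - y\<bar> * real N / (50 * B)"
    and Q: "(6 * (x - y)\<^sup>2 + real n * (4 * real W + 5) * B) * real N \<le> Q"
    and "M \<ge> 1"
    and large: "((8 * real W + 14) * real N) ^ (n - 1)
        * (32 * (real m)\<^sup>2 / real M + 16 * sqrt (real ((4 * W + 5) * N))) \<le> real N ^ (n - 1) * (real m)\<^sup>2 / 2"
  shows "real N ^ (n - 1) * (real m)\<^sup>2 / 2
    \<le> (2 * real M + 1) * real (card (algebraic_points_in n Q ({x - L / 4..x + L / 4} \<times> {y - L / 4..y + L / 4})))"
proof (rule card_algebraic_points_ge[OF \<open>M \<ge> 1\<close> _ _ large])
  fix \<tau> assume \<tau>: "\<tau> \<in> params"
  obtain b i j where bij: "\<tau> = (b, i, j)" by (metis prod.exhaust)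
  have b: "b \<in> {2..n} \<rightarrow>\<^sub>E {1..int N}" and ij: "0 \<le> i" "i < int m" "0 \<le> j" "j < int m"
    using \<tau> by (auto simp: params_def bij)
  define \<sigma> where "\<sigma> = (\<Sum>l = 2..n. high b l * \<alpha> l)"
  define \<rho> where "\<rho> = (\<Sum>l = 2..n. high b l * \<beta> l)"
  define e1 where "e1 = 4 * (p b + i) + \<sigma>"
  define e0 where "e0 = 4 * (q b + j) + 2 + \<rho>"
  \<comment> \<open>The floors put \<open>4 * p b + \<sigma>\<close> and
    \<open>4 * q b + \<rho>\<close> in \<open>(-4, 0]\<close>; adding \<open>4 * i\<close> or
    \<open>4 * j + 2\<close> stays within \<open>6 * m\<close> because
    \<open>m \<ge> 1\<close>.\<close>
  have "real_of_int i \<le> real m - 1" "real_of_int j \<le> real m - 1" using ij by linarith+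
  moreover have "0 \<le> real_of_int i" "0 \<le> real_of_int j" "1 \<le> real m" using ij m by auto
  moreover have "- 1 < p b - (- \<sigma> / 4)" "p b \<le> - \<sigma> / 4" "- 1 < q b - (- \<rho> / 4)" "q b \<le> - \<rho> / 4"
    unfolding p q \<sigma>_def \<rho>_def by linarith+
  ultimately have e01: "\<bar>e1\<bar> \<le> 6 * real m" "\<bar>e0\<bar> \<le> 6 * real m"
    unfolding e1_def e0_def by (simp_all add: abs_le_iff)
  have "real m * (50 * B) \<le> L * \<bar>x - y\<bar> * real N" using m(2) B(2) by (simp add: field_simps)
  then have mB: "50 * (real m * B) \<le> L * \<bar>x - y\<bar> * real N" by simp
  have mB1: "real m \<le> real m * B" using mult_left_mono[OF B(2), of "real m"] by simp
  have "R \<ge> 0" by (rule order_trans[OF _ R]) simp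
  define f where "f t = eval_real (fam \<tau>) t" for t
  have f: "f t = (t - x) * (t - y) * (\<Sum>l = 2..n. high b l * S l t) + (e1 * t + e0)" for t
    unfolding f_def bij eval_fam[OF pow] by (simp add: e1_def e0_def \<sigma>_def \<rho>_def)
  have cont: "continuous_on UNIV f" unfolding f_def eval_real_def by (intro continuous_intros)
  have lower: "real N \<le> (\<Sum>l = 2..n. high b l * S l t)" if "\<bar>t\<bar> \<le> R" for t
    using S[OF _ that] S2 W by (intro sum_high_ge[OF b]) auto
  have err: "\<bar>e1 * t + e0\<bar> < L / 4 * (\<bar>x - y\<bar> / 2) * real N" if "\<bar>t\<bar> \<le> R" for t
  proof -
    have "\<bar>e1 * t + e0\<bar> \<le> \<bar>e1\<bar> * \<bar>t\<bar> + \<bar>e0\<bar>" by (metis abs_mult abs_triangle_ineq)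
    also have "\<dots> \<le> 6 * real m * R + 6 * real m"
      using e01 that by (intro add_mono mult_mono) auto
    also have "\<dots> = 6 * (real m * (R + 1))" by (simp add: algebra_simps)
    also have "\<dots> \<le> 6 * (real m * B)" using B by (intro mult_left_mono) auto
    \<comment> \<open>Source of the 50 in the bound on \<open>m\<close>:
      \<open>6 / 50 < 1 / 8\<close>, where 8 is 4 from the radius \<open>L / 4\<close> times 2 from
      \<open>\<bar>x - y\<bar> / 2\<close>.\<close>
    also have "\<dots> < L * \<bar>x - y\<bar> * real N / 8" using mB mB1 m(1) by linarith
    finally show ?thesis by simp
  qed
  have near: "\<bar>t\<bar> \<le> R" if "\<bar>t - x\<bar> = L / 4 \<or> \<bar>t - y\<bar> = L / 4" for t
  proof -
    have "\<bar>t\<bar> \<le> L / 4 + (\<bar>x\<bar> + \<bar>y\<bar>)"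
      using that
    proof
      assume "\<bar>t - x\<bar> = L / 4"
      then have "\<bar>t\<bar> \<le> L / 4 + \<bar>x\<bar>" using abs_triangle_ineq[of "t - x" x] by simp
      also have "\<dots> \<le> L / 4 + (\<bar>x\<bar> + \<bar>y\<bar>)" by simp
      finally show ?thesis .
    next
      assume "\<bar>t - y\<bar> = L / 4"
      then have "\<bar>t\<bar> \<le> L / 4 + \<bar>y\<bar>" using abs_triangle_ineq[of "t - y" y] by simp
      also have "\<dots> \<le> L / 4 + (\<bar>x\<bar> + \<bar>y\<bar>)" by simp
      finally show ?thesis .
    qed
    also have "\<dots> \<le> (\<bar>x\<bar> + \<bar>y\<bar>) + (\<bar>x\<bar> + \<bar>y\<bar>)"
      using order_trans[OF L(2) abs_triangle_ineq4] L(1) by (intro add_right_mono) linarith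
    also have "\<dots> \<le> R" using R by simp
    finally show ?thesis .
  qed
  obtain r1 where r1: "\<bar>r1 - x\<bar> \<le> L / 4" "f r1 = 0"
    by (rule perturbed_root[OF f cont, of "L / 4" "real N" "L / 4 * (\<bar>x - y\<bar> / 2) * real N"])
      (use L N lower[OF near] err[OF near] in auto)
  have f': "f t = (t - y) * (t - x) * (\<Sum>l = 2..n. high b l * S l t) + (e1 * t + e0)" for t
    unfolding f by simp
  obtain r2 where r2: "\<bar>r2 - y\<bar> \<le> L / 4" "f r2 = 0"
    by (rule perturbed_root[OF f' cont, of "L / 4" "real N" "L / 4 * (\<bar>x - y\<bar> / 2) * real N"])
      (use L N lower[OF near] err[OF near] in \<open>auto simp: abs_minus_commute\<close>)
  show "\<exists>\<alpha>\<in>{x - L / 4..x + L / 4} \<times> {y - L / 4..y + L / 4}. vanishes_at (fam \<tau>) \<alpha>"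
    using r1(2) r2(2) r1(1)[unfolded abs_le_iff] r2(1)[unfolded abs_le_iff]
    by (intro bexI[of _ "(r1, r2)"]) (auto simp: vanishes_at_def f_def)
  fix l assume l: "l \<le> n"
  define H where "H = real n * (4 * real W + 5) * B"
  have \<sigma>\<rho>: "\<bar>\<sigma>\<bar> \<le> H * real N" "\<bar>\<rho>\<bar> \<le> H * real N"
    using sum_high_le[OF b \<alpha>\<beta>(1)] sum_high_le[OF b \<alpha>\<beta>(2)] by (simp_all add: \<sigma>_def \<rho>_def H_def algebra_simps)
  have "L * \<bar>x - y\<bar> * real N \<le> \<bar>x - y\<bar> * \<bar>x - y\<bar> * real N"
    using L by (intro mult_right_mono) auto
  then have "6 * real m \<le> 6 * (x - y)\<^sup>2 * real N"
    using mB mB1 by (simp add: power2_eq_square)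
  then have *: "6 * real m + H * real N \<le> Q"
    using Q by (simp add: H_def algebra_simps)
  show "\<bar>real_of_int (coef \<tau> l)\<bar> \<le> Q"
  proof (cases "l \<ge> 2")
    case True
    then have l': "l \<in> {2..n}" using l by simp
    have "real_of_int (high b l) \<le> real_of_int ((4 * int W + 5) * int N)"
      using high_bounds(2)[OF b l'] by (simp only: of_int_le_iff)
    also have "\<dots> = 1 * ((4 * real W + 5) * real N)" by simp
    also have "\<dots> \<le> (real n * B) * ((4 * real W + 5) * real N)"
      using mult_mono[of 1 "real n" 1 B] n B(2) by (intro mult_right_mono) auto
    also have "\<dots> = H * real N" by (simp add: H_def)
    finally have "real_of_int (high b l) \<le> Q" using * by simp
    then show ?thesis using True high_bounds(1)[OF b l'] by (simp add: bij)
  next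
    case False
    \<comment> \<open>A low coefficient is the small error minus the sum it was chosen to
      cancel.\<close>
    then consider "l = 0" | "l = 1" by linarith
    then show ?thesis
    proof cases
      case 1
      then have "real_of_int (coef \<tau> l) = e0 - \<rho>" by (simp add: bij e0_def)
      then show ?thesis
        using order_trans[OF abs_triangle_ineq4 add_mono] e01 \<sigma>\<rho> * by (metis order_trans)
    next
      case 2
      then have "real_of_int (coef \<tau> l) = e1 - \<sigma>" by (simp add: bij e1_def)
      then show ?thesis
        using order_trans[OF abs_triangle_ineq4 add_mono] e01 \<sigma>\<rho> * by (metis order_trans)
    qed
  qed
qed

end

section \<open>Counting algebraic points in the square\<close>

text \<open>The constant \<open>c\<close> is chosen before \<open>s\<close>, which enters only
  through \<open>Q0\<close>.\<close>

lemma card_algebraic_points_near_ge: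
  fixes x y :: real
  assumes n: "n \<ge> 2" and "x \<noteq> y"
  obtains c where "c > 0" and "\<And>s. s < 3/4 \<Longrightarrow> \<exists>Q0>0. \<forall>Q>Q0. \<forall>L. Q powr (- s) \<le> L \<and> L \<le> \<bar>x - y\<bar> \<longrightarrow>
    c * Q powr (real n + 1) * L\<^sup>2
      \<le> real (card (algebraic_points_in n Q ({x - L / 4..x + L / 4} \<times> {y - L / 4..y + L / 4})))"
proof -
  define \<Delta> where "\<Delta> = \<bar>x - y\<bar>"
  have \<Delta>: "\<Delta> > 0" using \<open>x \<noteq> y\<close> by (simp add: \<Delta>_def)
  define R where "R = 2 * (\<bar>x\<bar> + \<bar>y\<bar>)"
  obtain S \<alpha> \<beta> B where pow: "\<And>l t. t ^ l = (t - x) * (t - y) * S l t + \<alpha> l * t + \<beta> l" "\<And>t. S 2 t = 1"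
    "\<And>l t. l \<le> n \<Longrightarrow> \<bar>t\<bar> \<le> R \<Longrightarrow> \<bar>S l t\<bar> \<le> B"
    "\<And>l. l \<le> n \<Longrightarrow> \<bar>\<alpha> l\<bar> \<le> B" "\<And>l. l \<le> n \<Longrightarrow> \<bar>\<beta> l\<bar> \<le> B" and B: "B \<ge> R + 1" "B \<ge> 1"
    using powers_mod_quadratic_bounded[where x = x and y = y and R = R and n = n] by metis
  define W where "W = nat \<lceil>5 * real n * B\<rceil> + 1"
  have W: "5 * real n * B \<le> real W" "W \<ge> 1"
    unfolding W_def using of_nat_ceiling[of "5 * real n * B"] by (linarith, simp)
  \<comment> \<open>\<open>C * N\<close> bounds all coefficients, so \<open>N\<close> can be about
    \<open>Q / C\<close>.\<close>
  define C where "C = 6 * (x - y)\<^sup>2 + real n * (4 * real W + 5) * B"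
  have "1 * 1 \<le> real n * B" using n B(2) by (intro mult_mono) auto
  then have "(4 * real W + 5) * 1 \<le> (4 * real W + 5) * (real n * B)" by (intro mult_left_mono) auto
  also have "\<dots> \<le> C" by (simp add: C_def mult_ac)
  finally have CW: "4 * real W + 5 \<le> C" by simp
  then have C: "C \<ge> 1" by simp
  \<comment> \<open>Ensures \<open>\<kappa> * (L * Q) \<le> m\<close>: in 200 there is 50 from the
    bound on \<open>m\<close>, 2 from \<open>N \<ge> Q / (2 * C)\<close> and 2 from
    rounding.\<close>
  define \<kappa> where "\<kappa> = \<Delta> / (200 * B * C)"
  have \<kappa>: "\<kappa> > 0" using \<Delta> B C by (simp add: \<kappa>_def)
  define C1 where "C1 = (8 * real W + 14) ^ (n - 1)"
  have C1: "C1 \<ge> 1" unfolding C1_def by (intro one_le_power) auto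
  \<comment> \<open>As \<open>128 = 4 * 32\<close>, the \<open>1 / M\<close> part of the bad members
    costs at most a quarter of the family.\<close>
  define M where "M = nat \<lceil>128 * C1\<rceil>"
  have M: "128 * C1 \<le> real M" "M \<ge> 1" unfolding M_def using C1 by linarith+
  define c where "c = (1 / (2 * C)) ^ (n - 1) * \<kappa>\<^sup>2 / 2 / (2 * real M + 1)"
  have "\<exists>Q0>0. \<forall>Q>Q0. \<forall>L. Q powr (- s) \<le> L \<and> L \<le> \<bar>x - y\<bar> \<longrightarrow>
    c * Q powr (real n + 1) * L\<^sup>2
      \<le> real (card (algebraic_points_in n Q ({x - L / 4..x + L / 4} \<times> {y - L / 4..y + L / 4})))"
    if s: "s < 3/4" for s
  proof -
    \<comment> \<open>The exponent of \<open>Q\<close> in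
      \<open>(Q powr (- s) * Q)\<^sup>2 / sqrt Q\<close>; it is positive because
      \<open>s < 3/4\<close>.\<close>
    define e where "e = 3/2 - 2 * s"
    have e: "e > 0" using s by (simp add: e_def)
    \<comment> \<open>As \<open>64 = 4 * 16\<close>, having \<open>A \<le> Q powr e\<close> makes
      the square root part cost at most another quarter.\<close>
    define A where "A = 64 * C1 / \<kappa>\<^sup>2"
    have A: "A > 0" using C1 \<kappa> by (simp add: A_def)
    define Q0 where "Q0 = max (2 * C) (A powr (1 / e))"
    have main: "c * Q powr (real n + 1) * L\<^sup>2
      \<le> real (card (algebraic_points_in n Q ({x - L / 4..x + L / 4} \<times> {y - L / 4..y + L / 4})))"
      if Q: "Q > Q0" and L: "Q powr (- s) \<le> L" "L \<le> \<Delta>" for Q L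
    proof -
      have QC: "2 * C \<le> Q" and QA: "A powr (1 / e) \<le> Q" using Q by (simp_all add: Q0_def)
      have Q1: "Q \<ge> 1" using QC C by linarith
      have L0: "L > 0" using L(1) Q1 by (metis less_le_trans powr_gt_zero not_one_le_zero)
      define N where "N = nat \<lfloor>Q / C\<rfloor>"
      have QC': "Q / C \<ge> 2" using QC C by (simp add: field_simps)
      have NQ: "real N \<le> Q / C" and NQ': "Q / C - 1 \<le> real N" unfolding N_def using QC' by linarith+
      have N: "N \<ge> 1" using NQ' QC' by linarith
      have CN: "C * real N \<le> Q" using NQ C by (simp add: field_simps)
      have N2: "Q * (1 / (2 * C)) \<le> real N" using NQ' QC' by simp
      define z where "z = L * \<Delta> * real N / (50 * B)"
      have "L * \<Delta> * (Q * (1 / (2 * C))) / (50 * B) \<le> z"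
        unfolding z_def using L0 \<Delta> B N2 by (intro divide_right_mono mult_left_mono) auto
      moreover have "L * \<Delta> * (Q * (1 / (2 * C))) / (50 * B) = 2 * (\<kappa> * (L * Q))"
        using B C by (simp add: \<kappa>_def field_simps)
      ultimately have z: "2 * (\<kappa> * (L * Q)) \<le> z" by simp
      have "A \<le> Q powr e"
        using powr_mono2[of e "A powr (1 / e)" Q] A e QA by (simp add: powr_powr)
      then have "A * sqrt Q \<le> Q powr e * Q powr (1/2)"
        using Q1 by (simp add: powr_half_sqrt mult_right_mono)
      also have "\<dots> = (Q powr (- s) * Q)\<^sup>2"
      proof -
        have "Q powr (- s) * Q = Q powr (- s) * Q powr 1" using Q1 by simp
        also have "\<dots> = Q powr (1 - s)" by (simp only: flip: powr_add) simp
        finally show ?thesis by (simp add: e_def power2_eq_square flip: powr_add)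
      qed
      also have "\<dots> \<le> (L * Q)\<^sup>2" using L(1) Q1 by (intro power_mono mult_right_mono) auto
      finally have AQ: "64 * C1 * sqrt Q \<le> (\<kappa> * (L * Q))\<^sup>2"
        using \<kappa> by (simp add: A_def power_mult_distrib field_simps)
      \<comment> \<open>The same estimate yields \<open>\<kappa> * (L * Q) \<ge> 1\<close>, so
        rounding \<open>z\<close> down loses at most half of
        \<open>2 * (\<kappa> * (L * Q))\<close>.\<close>
      have "1 * 1 \<le> 64 * C1 * sqrt Q" using C1 Q1 by (intro mult_mono) auto
      then have "1\<^sup>2 \<le> (\<kappa> * (L * Q))\<^sup>2" using AQ by simp
      then have kLQ: "1 \<le> \<kappa> * (L * Q)"
        by (rule power2_le_imp_le) (use \<kappa> L0 Q1 in auto)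
      define m where "m = nat \<lfloor>z\<rfloor>"
      have m: "\<kappa> * (L * Q) \<le> real m" "real m \<le> z" unfolding m_def using z kLQ by linarith+
      have m1: "m \<ge> 1" using m(1) kLQ by linarith
      \<comment> \<open>\<open>high\<close> depends on \<open>n\<close>, \<open>W\<close> and
        \<open>N\<close> alone, so the windows can be defined before the interpretation that takes
        them as parameters.\<close>
      define p where "p b = \<lfloor>- (\<Sum>l = 2..n. eisenstein_family.high n W N b l * \<alpha> l) / 4\<rfloor>" for b
      define q where "q b = \<lfloor>- (\<Sum>l = 2..n. eisenstein_family.high n W N b l * \<beta> l) / 4\<rfloor>" for b
      interpret eisenstein_family n W N m p q using n N by unfold_locales
      have m2: "(\<kappa> * (L * Q))\<^sup>2 \<le> (real m)\<^sup>2" using m kLQ by (intro power_mono) auto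
      have "c * Q powr (real n + 1) * L\<^sup>2 * (2 * real M + 1) \<le> real N ^ (n - 1) * (real m)\<^sup>2 / 2"
      proof -
        have "Q powr (real n + 1) = Q ^ (n - 1) * Q\<^sup>2"
          using n Q1 powr_realpow[of Q "n + 1"] by (simp add: add.commute flip: power_add)
        then have "c * Q powr (real n + 1) * L\<^sup>2 * (2 * real M + 1) = (Q * (1 / (2 * C))) ^ (n - 1) * (\<kappa> * (L * Q))\<^sup>2 / 2"
          unfolding c_def by (simp add: power_mult_distrib power_divide)
        also have "\<dots> \<le> real N ^ (n - 1) * (real m)\<^sup>2 / 2"
          using N2 m(1) kLQ Q1 C by (intro divide_right_mono mult_mono power_mono) auto
        finally show ?thesis .
      qed
      also have "\<dots> \<le> (2 * real M + 1) * real (card (algebraic_points_in n Q ({x - L / 4..x + L / 4} \<times> {y - L / 4..y + L / 4})))"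
      proof (rule card_points_near_ge[OF pow B _ _ _ W L0])
        show "L \<le> \<bar>x - y\<bar>" "real m \<le> L * \<bar>x - y\<bar> * real N / (50 * B)"
          using L(2) m(2) by (simp_all add: \<Delta>_def z_def)
        show "(6 * (x - y)\<^sup>2 + real n * (4 * real W + 5) * B) * real N \<le> Q"
          using CN by (simp add: C_def)
        have "real ((4 * W + 5) * N) \<le> Q"
          using CN mult_right_mono[OF CW, of "real N"] by simp
        then have "C1 * (16 * sqrt (real ((4 * W + 5) * N))) \<le> C1 * (16 * sqrt Q)"
          using C1 by (intro mult_left_mono) auto
        also have "\<dots> \<le> (real m)\<^sup>2 / 4" using AQ m2 by simp
        finally have "C1 * (16 * sqrt (real ((4 * W + 5) * N))) \<le> (real m)\<^sup>2 / 4" .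
        moreover have "C1 * (32 * (real m)\<^sup>2 / real M) \<le> (real m)\<^sup>2 / 4"
          using mult_right_mono[OF M(1), of "(real m)\<^sup>2"] M(2) by (simp add: field_simps)
        ultimately have "C1 * (32 * (real m)\<^sup>2 / real M + 16 * sqrt (real ((4 * W + 5) * N))) \<le> (real m)\<^sup>2 / 2"
          by (simp add: distrib_left)
        then have "real N ^ (n - 1) * (C1 * (32 * (real m)\<^sup>2 / real M + 16 * sqrt (real ((4 * W + 5) * N))))
            \<le> real N ^ (n - 1) * ((real m)\<^sup>2 / 2)"
          by (intro mult_left_mono) auto
        then show "((8 * real W + 14) * real N) ^ (n - 1)
            * (32 * (real m)\<^sup>2 / real M + 16 * sqrt (real ((4 * W + 5) * N))) \<le> real N ^ (n - 1) * (real m)\<^sup>2 / 2"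
          by (simp add: C1_def power_mult_distrib mult_ac)
      qed (use m1 M(2) in \<open>simp_all add: R_def p_def q_def\<close>)
      finally have "c * Q powr (real n + 1) * L\<^sup>2 * (2 * real M + 1)
        \<le> real (card (algebraic_points_in n Q ({x - L / 4..x + L / 4} \<times> {y - L / 4..y + L / 4}))) * (2 * real M + 1)"
        by (simp only: mult.commute)
      then show ?thesis by (rule mult_right_le_imp_le) simp
    qed
    have "Q0 > 0" using C by (simp add: Q0_def)
    with main show ?thesis by (intro exI[of _ Q0]) (auto simp: \<Delta>_def)
  qed
  moreover have "c > 0" using C \<kappa> by (simp add: c_def)
  ultimately show ?thesis using that by blast
qed

text \<open>\<open>I\<close> may or may not contain its endpoints: its measure is squeezed between
  those of the open and the closed interval, and membership is claimed strictly inside.\<close>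

lemma interval_around_midpoint:
  fixes I :: "real set"
  assumes I: "is_interval I" "bounded I" "measure lborel I = L" "L > 0"
    and d: "midpoint (Inf I) (Sup I) = d"
  shows "Sup I - Inf I = L" and "\<And>t. \<bar>t - d\<bar> < L / 2 \<Longrightarrow> t \<in> I" and "I \<subseteq> {Inf I..Sup I}"
proof -
  have "I \<noteq> {}" using I by auto
  have bdd: "bdd_above I" "bdd_below I"
    using I(2) by (auto simp: bounded_imp_bdd_above bounded_imp_bdd_below)
  have inner: "t \<in> I" if t: "Inf I < t" "t < Sup I" for t
  proof -
    obtain u v where "u \<in> I" "u < t" "v \<in> I" "t < v"
      using t bdd \<open>I \<noteq> {}\<close> by (metis cInf_less_iff less_cSup_iff)
    then show ?thesis using I(1) unfolding is_interval_1 by (metis less_imp_le)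
  qed
  show outer: "I \<subseteq> {Inf I..Sup I}" using bdd by (auto intro: cInf_lower cSup_upper)
  have le: "Inf I \<le> Sup I" using \<open>I \<noteq> {}\<close> outer by fastforce
  have meas: "I \<in> sets lborel" using real_interval_borel_measurable[OF I(1)] by simp
  have fin: "{Inf I..Sup I} \<in> fmeasurable lborel" by (rule fmeasurableI) (use le in auto)
  have "I \<in> fmeasurable lborel"
    by (rule fmeasurableI2[OF fin]) (use outer meas in auto)
  then have "measure lborel {Inf I<..<Sup I} \<le> measure lborel I"
    using inner by (intro measure_mono_fmeasurable) auto
  moreover have "measure lborel I \<le> measure lborel {Inf I..Sup I}"
    using outer meas fin by (intro measure_mono_fmeasurable) auto
  ultimately show len: "Sup I - Inf I = L" using le I(3) by simp
  show "t \<in> I" if "\<bar>t - d\<bar> < L / 2" for t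
  proof (rule inner)
    have "Inf I + Sup I = 2 * d" using d by (simp add: midpoint_def field_simps)
    moreover have "t - d < L / 2" "d - t < L / 2" using that by (simp_all only: abs_less_iff) auto
    ultimately show "Inf I < t" "t < Sup I" using len by linarith+
  qed
qed

theorem theorem2:
  fixes n :: nat and \<epsilon> K :: real and d :: "real \<times> real"
  assumes "n \<ge> 2" and "\<epsilon> > 0" and "K > 0"
  shows "\<exists>c\<^sub>0>0. \<exists>c\<^sub>4>0. \<forall>s. 1/2 < s \<and> s < 3/4 \<longrightarrow>
    (\<exists>Q\<^sub>0>0. \<forall>Q>Q\<^sub>0. \<forall>c\<^sub>3>c\<^sub>0. \<forall>I\<^sub>1 I\<^sub>2 :: real set.
       is_interval I\<^sub>1 \<and> is_interval I\<^sub>2 \<and> bounded I\<^sub>1 \<and> bounded I\<^sub>2 \<and>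
       measure lborel I\<^sub>1 = c\<^sub>3 * Q powr (- s) \<and> measure lborel I\<^sub>2 = c\<^sub>3 * Q powr (- s) \<and>
       (midpoint (Inf I\<^sub>1) (Sup I\<^sub>1), midpoint (Inf I\<^sub>2) (Sup I\<^sub>2)) = d \<and>
       (I\<^sub>1 \<times> I\<^sub>2) \<inter> {(x\<^sub>1, x\<^sub>2). \<bar>x\<^sub>1 - x\<^sub>2\<bar> < \<epsilon>} = {} \<and>
       ordinary K s (1/2) (1/2) Q (I\<^sub>1 \<times> I\<^sub>2) \<longrightarrow>
       real (card (algebraic_points_in n Q (I\<^sub>1 \<times> I\<^sub>2)))
         \<ge> c\<^sub>4 * Q powr (real n + 1) * measure lborel (I\<^sub>1 \<times> I\<^sub>2))"
proof -
  obtain x y where d: "d = (x, y)" by (metis prod.exhaust)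
  \<comment> \<open>The closed square of half the side stays strictly inside, whichever endpoints
    the intervals contain.\<close>
  have square: "L > 0 \<and> L \<le> \<bar>x - y\<bar> \<and> x \<noteq> y \<and> measure lborel (I\<^sub>1 \<times> I\<^sub>2) \<le> L\<^sup>2 \<and>
      {x - L / 4..x + L / 4} \<times> {y - L / 4..y + L / 4} \<subseteq> I\<^sub>1 \<times> I\<^sub>2"
    if I1: "is_interval I\<^sub>1" "bounded I\<^sub>1" "measure lborel I\<^sub>1 = L" "midpoint (Inf I\<^sub>1) (Sup I\<^sub>1) = x"
      and I2: "is_interval I\<^sub>2" "bounded I\<^sub>2" "measure lborel I\<^sub>2 = L" "midpoint (Inf I\<^sub>2) (Sup I\<^sub>2) = y"
      and L: "L > 0" and sep: "(I\<^sub>1 \<times> I\<^sub>2) \<inter> {(x\<^sub>1, x\<^sub>2). \<bar>x\<^sub>1 - x\<^sub>2\<bar> < \<epsilon>} = {}"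
    for L and I\<^sub>1 I\<^sub>2 :: "real set"
  proof -
    note A = interval_around_midpoint[OF I1(1,2,3) L I1(4)]
    note B = interval_around_midpoint[OF I2(1,2,3) L I2(4)]
    have far: "\<epsilon> \<le> \<bar>u - v\<bar>" if "u \<in> I\<^sub>1" "v \<in> I\<^sub>2" for u v
      using sep that by force
    have "L \<le> \<bar>x - y\<bar>"
    proof (rule ccontr)
      assume "\<not> L \<le> \<bar>x - y\<bar>"
      \<comment> \<open>The average of \<open>x\<close> and \<open>y\<close> would lie in both
        intervals and give a point of the excluded strip on the diagonal.\<close>
      then have "(x + y) / 2 \<in> I\<^sub>1" "(x + y) / 2 \<in> I\<^sub>2"
        by (intro A(2) B(2); simp add: field_simps abs_if split: if_splits)+
      then show False using far[of "(x + y) / 2" "(x + y) / 2"] \<open>\<epsilon> > 0\<close> by simp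
    qed
    moreover have "measure lborel (I\<^sub>1 \<times> I\<^sub>2) \<le> L\<^sup>2"
    proof -
      have "I\<^sub>1 \<times> I\<^sub>2 \<subseteq> cbox (Inf I\<^sub>1, Inf I\<^sub>2) (Sup I\<^sub>1, Sup I\<^sub>2)"
        using A(3) B(3) by (auto simp: cbox_Pair_eq)
      moreover have "I\<^sub>1 \<times> I\<^sub>2 \<in> sets lborel"
        using real_interval_borel_measurable[OF I1(1)] real_interval_borel_measurable[OF I2(1)]
        by (simp add: borel_prod[symmetric])
      ultimately have "measure lborel (I\<^sub>1 \<times> I\<^sub>2) \<le> measure lborel (cbox (Inf I\<^sub>1, Inf I\<^sub>2) (Sup I\<^sub>1, Sup I\<^sub>2))"
        by (intro measure_mono_fmeasurable) auto
      also have "\<dots> = L\<^sup>2"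
        using A(1) B(1) L by (simp add: content_Pair power2_eq_square)
      finally show ?thesis .
    qed
    moreover have "{x - L / 4..x + L / 4} \<times> {y - L / 4..y + L / 4} \<subseteq> I\<^sub>1 \<times> I\<^sub>2"
      using L by (intro Sigma_mono subsetI A(2) B(2)) (auto simp: abs_if)
    ultimately show ?thesis using L by auto
  qed
  show ?thesis
  proof (cases "x = y")
    case True
    \<comment> \<open>By \<open>square\<close> an admissible square forces
      \<open>x \<noteq> y\<close>, so the claim is vacuous here and the constants are
      arbitrary.\<close>
    show ?thesis
      by (rule exI[of _ 1], rule conjI, simp, rule exI[of _ 1], rule conjI, simp, intro allI impI,
          rule exI[of _ 1], rule conjI, simp, intro allI impI)
        (use square True d in fastforce)
  next
    case False
    obtain c where c: "c > 0" and near: "\<And>s. s < 3/4 \<Longrightarrow> \<exists>Q0>0. \<forall>Q>Q0. \<forall>L. Q powr (- s) \<le> L \<and> L \<le> \<bar>x - y\<bar> \<longrightarrow>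
      c * Q powr (real n + 1) * L\<^sup>2
        \<le> real (card (algebraic_points_in n Q ({x - L / 4..x + L / 4} \<times> {y - L / 4..y + L / 4})))"
      using card_algebraic_points_near_ge[OF \<open>n \<ge> 2\<close> False] by metis
    \<comment> \<open>\<open>c\<^sub>0 = 1\<close> works because \<open>c\<^sub>3 > 1\<close> gives
      \<open>Q powr (- s) \<le> L\<close>.\<close>
    show ?thesis
    proof (rule exI[of _ 1], rule conjI, simp, rule exI[of _ c], rule conjI, fact c, intro allI impI)
      fix s :: real assume s: "1/2 < s \<and> s < 3/4"
      then obtain Q0 where Q0: "Q0 > 0" "\<And>Q L. Q > Q0 \<Longrightarrow> Q powr (- s) \<le> L \<Longrightarrow> L \<le> \<bar>x - y\<bar> \<Longrightarrow>
        c * Q powr (real n + 1) * L\<^sup>2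
          \<le> real (card (algebraic_points_in n Q ({x - L / 4..x + L / 4} \<times> {y - L / 4..y + L / 4})))"
        using near by metis
      show "\<exists>Q\<^sub>0>0. \<forall>Q>Q\<^sub>0. \<forall>c\<^sub>3>1. \<forall>I\<^sub>1 I\<^sub>2 :: real set.
       is_interval I\<^sub>1 \<and> is_interval I\<^sub>2 \<and> bounded I\<^sub>1 \<and> bounded I\<^sub>2 \<and>
       measure lborel I\<^sub>1 = c\<^sub>3 * Q powr (- s) \<and> measure lborel I\<^sub>2 = c\<^sub>3 * Q powr (- s) \<and>
       (midpoint (Inf I\<^sub>1) (Sup I\<^sub>1), midpoint (Inf I\<^sub>2) (Sup I\<^sub>2)) = d \<and>
       (I\<^sub>1 \<times> I\<^sub>2) \<inter> {(x\<^sub>1, x\<^sub>2). \<bar>x\<^sub>1 - x\<^sub>2\<bar> < \<epsilon>} = {} \<and>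
       ordinary K s (1/2) (1/2) Q (I\<^sub>1 \<times> I\<^sub>2) \<longrightarrow>
       c * Q powr (real n + 1) * measure lborel (I\<^sub>1 \<times> I\<^sub>2)
         \<le> real (card (algebraic_points_in n Q (I\<^sub>1 \<times> I\<^sub>2)))"
      proof (rule exI[of _ Q0], rule conjI, fact Q0(1), intro allI impI, elim conjE)
        fix Q c\<^sub>3 :: real and I\<^sub>1 I\<^sub>2 :: "real set"
        assume Q: "Q > Q0" and c3: "c\<^sub>3 > 1" and I: "is_interval I\<^sub>1" "is_interval I\<^sub>2" "bounded I\<^sub>1" "bounded I\<^sub>2"
          "measure lborel I\<^sub>1 = c\<^sub>3 * Q powr (- s)" "measure lborel I\<^sub>2 = c\<^sub>3 * Q powr (- s)"
          and mid: "(midpoint (Inf I\<^sub>1) (Sup I\<^sub>1), midpoint (Inf I\<^sub>2) (Sup I\<^sub>2)) = d"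
          and sep: "(I\<^sub>1 \<times> I\<^sub>2) \<inter> {(x\<^sub>1, x\<^sub>2). \<bar>x\<^sub>1 - x\<^sub>2\<bar> < \<epsilon>} = {}"
        define L where "L = c\<^sub>3 * Q powr (- s)"
        have "L > 0" using c3 Q Q0(1) by (simp add: L_def)
        then have sq: "L \<le> \<bar>x - y\<bar>" "measure lborel (I\<^sub>1 \<times> I\<^sub>2) \<le> L\<^sup>2"
          "{x - L / 4..x + L / 4} \<times> {y - L / 4..y + L / 4} \<subseteq> I\<^sub>1 \<times> I\<^sub>2"
          using square[of I\<^sub>1 L I\<^sub>2] I mid sep d unfolding L_def by auto
        have "Q powr (- s) \<le> L" using c3 by (simp add: L_def mult_le_cancel_right1)
        have "c * Q powr (real n + 1) * measure lborel (I\<^sub>1 \<times> I\<^sub>2) \<le> c * Q powr (real n + 1) * L\<^sup>2"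
          using sq(2) c by (intro mult_left_mono) auto
        also have "\<dots> \<le> real (card (algebraic_points_in n Q ({x - L / 4..x + L / 4} \<times> {y - L / 4..y + L / 4})))"
          by (rule Q0(2)) (fact Q \<open>Q powr (- s) \<le> L\<close> sq(1))+
        also have "\<dots> \<le> real (card (algebraic_points_in n Q (I\<^sub>1 \<times> I\<^sub>2)))"
          unfolding algebraic_points_in_def of_nat_le_iff
          using sq(3) finite_algebraic_points by (intro card_mono) auto
        finally show "c * Q powr (real n + 1) * measure lborel (I\<^sub>1 \<times> I\<^sub>2)
          \<le> real (card (algebraic_points_in n Q (I\<^sub>1 \<times> I\<^sub>2)))" .
      qed
    qed
  qed
qed

end
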